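(* Assume the setting below. Let $H>G$ be a constant, assume $h<1$, and let $$M_2=M_1+\frac{G}{H}\Big[\frac{\mu}{1-[(G/H)h]^2}\Big]\frac{1}{[\sin(\pi/(2r+2))]^2}.$$ Suppose $0<M'<M$, $M\ge M_2$, and $\mathbf{L}_{s,\nu}(K_M(T))\subset K_{M'}(T)$. Then the spectral radius $R(\mathbf{L}_{s,\nu})$ of $\mathbf{L}_{s,\nu}$ satisfies $$\lambda_s^\nu(1-Hh^r)\le R(\mathbf{L}_{s,\nu})\le\lambda_s^\nu(1+Hh^r).$$
   Context: Setting. Let $a<b$, $S=[a,b]$, $n\ge1$, $s>0$, integers $r\ge1$, $m\ge r+1$. For $1\le p\le n$, $\theta_p:S\to S$ and $g_p:S\to[0,\infty)$ are $C^m$, $g_p$ not identically zero, and there is $M_0>0$ with $g_p(t_1)\le g_p(t_2)e^{M_0|t_1-t_2|}$ for all $t_1,t_2\in S$. For $\nu\ge1$, $\Omega_\nu=\{1,\dots,n\}^\nu$; for $\omega=(p_1,\dots,p_\nu)$, $\theta_\omega=\theta_{p_1}\circ\cdots\circ\theta_{p_\nu}$, $g_\omega(t)=g_{p_1}(\theta_{p_2}\circ\cdots\circ\theta_{p_\nu}(t))\cdots g_{p_{\nu-1}}(\theta_{p_\nu}(t))g_{p_\nu}(t)$. There are $C_0\ge1$, $0<\kappa<1$ with $|\theta_\omega(t_1)-\theta_\omega(t_2)|\le C_0\kappa^\nu|t_1-t_2|$ for all $\nu,\omega,t_1,t_2$. $(L_sf)(t)=\sum_pg_p(t)^sf(\theta_p(t))$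 on $C(S)$; $\lambda_s$ its spectral radius; $v_s\in C^m(S)$ a strictly positive eigenfunction with $L_sv_s=\lambda_sv_s$ (which exists under these hypotheses). $E,\chi>0$ satisfy $\sup_S|v_s^{(r+1)}|/v_s\le E$ and $v_s(x_1)\le v_s(x_2)e^{2s|x_1-x_2|/\chi}$ on $S$. A positive integer $\nu$ is fixed; pairwise disjoint nonempty compact intervals $[a_i,b_i]\subset S$, $1\le i\le I$, $b_i<a_{i+1}$, such that each $\theta_\omega(S)$, $\omega\in\Omega_\nu$, lies in some $[a_i,b_i]$. Positive integers $N_i$; $h_i=(b_i-a_i)/N_i$, $h=\max_ih_i$, $\mu=h/\min_ih_i$, $t^i_j=a_i+jh_i$; assume $2[\sin(\pi/(2r+2))]^2h_i\le a_{i+1}-b_i$ for $1\le i<I$. $\hat c_k=-\cos(\tfrac{2k+1}{2r+2}\pi)/\cos(\tfrac{\pi}{2r+2})$, $c^i_{j,k}=t^i_{j-1}+h_i(1+\hat c_k)/2$; $T$ is the set of all $c^i_{j,k}$. For $F:T\to\mathbb{R}$, $\mathcal{F}$ is the continuous function on $\bigcup_i[a_i,b_i]$ equal on each $[t^i_{j-1},t^i_j]$ to the polynomial of degree $\le r$ interpolating $F$ at $c^i_{j,0},\dots,c^i_{j,r}$. $K_M(T)=\{F:T\to\mathbb{R}:F(\xi)\le e^{M|\xi-\eta|}F(\eta)\ \forall\xi,\eta\in T\}$; $(\mathbf{L}_{s,\nu}F)(\xi)=\sum_{\omega\in\Omega_\nu}g_\omega(\xi)^s\mathcal{F}(\theta_\omega(\xi))$,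 $\xi\in T$. $G=E\,e^{2sh/\chi}\frac{1}{(r+1)!}\big[\frac{1}{2\cos(\pi/(2r+2))}\big]^{r+1}\frac{1}{2^r}$; assume $Gh^{r+1}<1$; $M_1=\mu\frac{Gh^r}{1-G^2h^{2r+2}}\big[\frac{1}{\sin(\pi/(2r+2))}\big]^2+\frac{2s}{\chi}$. *)

theory Defs
  imports "HOL-Analysis.Analysis" "HOL-Computational_Algebra.Polynomial"
begin

text \<open>Derivatives relative to S (one-sided at the endpoints when S is a closed interval).\<close>

primrec nth_deriv_on :: "real set \<Rightarrow> nat \<Rightarrow> (real \<Rightarrow> real) \<Rightarrow> real \<Rightarrow> real" where
  "nth_deriv_on S 0 f = f"
| "nth_deriv_on S (Suc k) f = (\<lambda>x. vector_derivative (nth_deriv_on S k f) (at x within S))"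

definition Cm_on :: "nat \<Rightarrow> real set \<Rightarrow> (real \<Rightarrow> real) \<Rightarrow> bool" where
  "Cm_on m S f \<longleftrightarrow>
     (\<forall>k<m. \<forall>x\<in>S. nth_deriv_on S k f differentiable (at x within S)) \<and>
     continuous_on S (nth_deriv_on S m f)"

text \<open>
  Spectral radius of a bounded real-linear operator \<open>A\<close> on the real Banach space C(X) with the
  sup norm, X a nonempty compact set of reals: the supremum of the moduli of the points in the
  spectrum of the complexification of \<open>A\<close>, which acts on C(X) with complex values.
  Functions on X are represented as members of \<open>extensional X\<close>. If X is finite,
  C(X) consists of all functions on X and the spectrum is the set of complex eigenvalues.
\<close>

definition CX :: "real set \<Rightarrow> (real \<Rightarrow> complex) set" where
  "CX X = {f \<in> extensional X. continuous_on X f}"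

definition sup_norm_on :: "real set \<Rightarrow> (real \<Rightarrow> complex) \<Rightarrow> real" where
  "sup_norm_on X f = (SUP x\<in>X. cmod (f x))"

definition complexify_op ::
    "real set \<Rightarrow> ((real \<Rightarrow> real) \<Rightarrow> real \<Rightarrow> real) \<Rightarrow> (real \<Rightarrow> complex) \<Rightarrow> real \<Rightarrow> complex" where
  "complexify_op X A f =
     (\<lambda>x\<in>X. Complex (A (\<lambda>y\<in>X. Re (f y)) x) (A (\<lambda>y\<in>X. Im (f y)) x))"

definition shifted_op ::
    "real set \<Rightarrow> ((real \<Rightarrow> real) \<Rightarrow> real \<Rightarrow> real) \<Rightarrow> complex \<Rightarrow> (real \<Rightarrow> complex) \<Rightarrow> real \<Rightarrow> complex" where
  "shifted_op X A z f = (\<lambda>x\<in>X. z * f x - complexify_op X A f x)"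

text \<open>The norm estimate says that the inverse of the shifted operator is bounded.\<close>

definition op_spectrum :: "real set \<Rightarrow> ((real \<Rightarrow> real) \<Rightarrow> real \<Rightarrow> real) \<Rightarrow> complex set" where
  "op_spectrum X A =
     {z. \<not> (bij_betw (shifted_op X A z) (CX X) (CX X) \<and>
            (\<exists>c. \<forall>f\<in>CX X. sup_norm_on X f \<le> c * sup_norm_on X (shifted_op X A z f)))}"

definition op_spectral_radius :: "real set \<Rightarrow> ((real \<Rightarrow> real) \<Rightarrow> real \<Rightarrow> real) \<Rightarrow> real" where
  "op_spectral_radius X A = (SUP z\<in>op_spectrum X A. cmod z)"

definition transfer_op ::
    "real set \<Rightarrow> nat \<Rightarrow> (nat \<Rightarrow> real \<Rightarrow> real) \<Rightarrow> (nat \<Rightarrow> real \<Rightarrow> real) \<Rightarrow> real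
      \<Rightarrow> (real \<Rightarrow> real) \<Rightarrow> real \<Rightarrow> real" where
  "transfer_op S n \<theta> g s f = (\<lambda>t\<in>S. \<Sum>p=1..n. g p t powr s * f (\<theta> p t))"

definition words :: "nat \<Rightarrow> nat \<Rightarrow> nat list set" where
  "words n \<nu> = {\<omega>. length \<omega> = \<nu> \<and> set \<omega> \<subseteq> {1..n}}"

primrec word_map :: "(nat \<Rightarrow> real \<Rightarrow> real) \<Rightarrow> nat list \<Rightarrow> real \<Rightarrow> real" where
  "word_map \<theta> [] = id"
| "word_map \<theta> (p # \<omega>) = \<theta> p \<circ> word_map \<theta> \<omega>"

primrec word_weight ::
    "(nat \<Rightarrow> real \<Rightarrow> real) \<Rightarrow> (nat \<Rightarrow> real \<Rightarrow> real) \<Rightarrow> nat list \<Rightarrow> real \<Rightarrow> real" where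
  "word_weight \<theta> g [] = (\<lambda>t. 1)"
| "word_weight \<theta> g (p # \<omega>) = (\<lambda>t. g p (word_map \<theta> \<omega> t) * word_weight \<theta> g \<omega> t)"

text \<open>
  The grid: intervals \<open>{lo i..hi i}\<close> for i = 1..I, the i-th one divided into \<open>N i\<close> equal
  pieces numbered j = 1..\<open>N i\<close>, each carrying the r + 1 extended Chebyshev points k = 0..r.
\<close>

definition mesh_width :: "(nat \<Rightarrow> real) \<Rightarrow> (nat \<Rightarrow> real) \<Rightarrow> (nat \<Rightarrow> nat) \<Rightarrow> nat \<Rightarrow> real" where
  "mesh_width lo hi N i = (hi i - lo i) / real (N i)"

definition mesh_point ::
    "(nat \<Rightarrow> real) \<Rightarrow> (nat \<Rightarrow> real) \<Rightarrow> (nat \<Rightarrow> nat) \<Rightarrow> nat \<Rightarrow> nat \<Rightarrow> real" where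
  "mesh_point lo hi N i j = lo i + real j * mesh_width lo hi N i"

definition cheb_ref :: "nat \<Rightarrow> nat \<Rightarrow> real" where
  "cheb_ref r k = - cos (real (2 * k + 1) / real (2 * r + 2) * pi) / cos (pi / real (2 * r + 2))"

definition cheb_point ::
    "nat \<Rightarrow> (nat \<Rightarrow> real) \<Rightarrow> (nat \<Rightarrow> real) \<Rightarrow> (nat \<Rightarrow> nat) \<Rightarrow> nat \<Rightarrow> nat \<Rightarrow> nat \<Rightarrow> real" where
  "cheb_point r lo hi N i j k =
     mesh_point lo hi N i (j - 1) + mesh_width lo hi N i * (1 + cheb_ref r k) / 2"

definition cheb_grid ::
    "nat \<Rightarrow> nat \<Rightarrow> (nat \<Rightarrow> real) \<Rightarrow> (nat \<Rightarrow> real) \<Rightarrow> (nat \<Rightarrow> nat) \<Rightarrow> real set" where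
  "cheb_grid r I lo hi N =
     {cheb_point r lo hi N i j k | i j k. i \<in> {1..I} \<and> j \<in> {1..N i} \<and> k \<in> {0..r}}"

text \<open>
  The value at x is unambiguous: the end points of each piece are themselves nodes
  (k = 0 and k = r), so the two polynomials agree at a point shared by adjacent pieces.
\<close>

definition pw_interpolant ::
    "nat \<Rightarrow> nat \<Rightarrow> (nat \<Rightarrow> real) \<Rightarrow> (nat \<Rightarrow> real) \<Rightarrow> (nat \<Rightarrow> nat)
      \<Rightarrow> (real \<Rightarrow> real) \<Rightarrow> real \<Rightarrow> real" where
  "pw_interpolant r I lo hi N F x =
     (THE y. \<exists>i\<in>{1..I}. \<exists>j\<in>{1..N i}. \<exists>q :: real poly.
        x \<in> {mesh_point lo hi N i (j - 1)..mesh_point lo hi N i j} \<and>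
        degree q \<le> r \<and>
        (\<forall>k\<in>{0..r}. poly q (cheb_point r lo hi N i j k) = F (cheb_point r lo hi N i j k)) \<and>
        y = poly q x)"

definition log_lip_cone :: "real \<Rightarrow> real set \<Rightarrow> (real \<Rightarrow> real) set" where
  "log_lip_cone M T =
     {F \<in> extensional T. \<forall>\<xi>\<in>T. \<forall>\<eta>\<in>T. F \<xi> \<le> exp (M * \<bar>\<xi> - \<eta>\<bar>) * F \<eta>}"

definition discrete_op ::
    "nat \<Rightarrow> (nat \<Rightarrow> real \<Rightarrow> real) \<Rightarrow> (nat \<Rightarrow> real \<Rightarrow> real) \<Rightarrow> real \<Rightarrow> nat
      \<Rightarrow> nat \<Rightarrow> nat \<Rightarrow> (nat \<Rightarrow> real) \<Rightarrow> (nat \<Rightarrow> real) \<Rightarrow> (nat \<Rightarrow> nat)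
      \<Rightarrow> (real \<Rightarrow> real) \<Rightarrow> real \<Rightarrow> real" where
  "discrete_op n \<theta> g s \<nu> r I lo hi N F =
     (\<lambda>\<xi>\<in>cheb_grid r I lo hi N. \<Sum>\<omega>\<in>words n \<nu>.
        word_weight \<theta> g \<omega> \<xi> powr s * pw_interpolant r I lo hi N F (word_map \<theta> \<omega> \<xi>))"

end

theory Submission
  imports Defs
begin

text \<open>
  The discrete operator is not positive, because interpolation of degree \<open>r \<ge> 2\<close> does not preserve
  positivity, so it is compared with \<open>\<lambda>\<^sup>\<nu>\<close> in the order induced by the cone \<open>K\<^sub>M(T)\<close>, which it
  does preserve. The Chebyshev interpolation error shows that the restriction of \<open>v\<close> to the grid
  satisfies \<open>\<bar>L v - \<lambda>\<^sup>\<nu> v\<bar> \<le> \<lambda>\<^sup>\<nu> G h\<^sup>r\<^sup>+\<^sup>1 v\<close> pointwise. Distinct grid points are at least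
  \<open>2 sin\<^sup>2(\<pi>/(2r+2)) h/\<mu>\<close> apart, so a function with relative distance \<open>\<epsilon>\<close> from an element of
  \<open>K\<^sub>A(T)\<close> lies in \<open>K\<^sub>B(T)\<close> with \<open>B - A = \<epsilon> \<mu> / ((1 - \<epsilon>\<^sup>2) h sin\<^sup>2(\<pi>/(2r+2)))\<close>. With
  \<open>\<epsilon> = G h / H\<close> this puts \<open>\<lambda>\<^sup>\<nu> H h\<^sup>r v \<plusminus> (L v - \<lambda>\<^sup>\<nu> v)\<close> into \<open>K\<^sub>M(T)\<close>, that is,
  \<open>\<lambda>\<^sup>\<nu>(1 - H h\<^sup>r) v \<le> L v \<le> \<lambda>\<^sup>\<nu>(1 + H h\<^sup>r) v\<close> in the cone order. Since \<open>v\<close> is an order unit,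
  iterating the upper estimate bounds the powers of \<open>L\<close> and hence its spectrum, and a
  Collatz--Wielandt argument turns the lower estimate into an eigenvalue.
\<close>

section \<open>Interpolation error at Chebyshev nodes\<close>

text \<open>Rolle's theorem between consecutive zeros, with input and output of the same shape so
  that it can be iterated. One-sided derivatives at the ends do no harm, since Rolle evaluates
  derivatives at interior points.\<close>

lemma zeros_of_derivative_between:
  fixes f f' :: "real \<Rightarrow> real" and z :: "nat \<Rightarrow> real"
  assumes der: "\<And>x. x \<in> {\<alpha>..\<beta>} \<Longrightarrow> (f has_real_derivative f' x) (at x within {\<alpha>..\<beta>})"
    and z: "\<And>i. i \<le> Suc n \<Longrightarrow> z i \<in> {\<alpha>..\<beta>} \<and> f (z i) = 0"
    and less: "\<And>i. i \<le> n \<Longrightarrow> z i < z (Suc i)"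
  shows "\<exists>y. (\<forall>i\<le>n. y i \<in> {\<alpha>..\<beta>} \<and> f' (y i) = 0) \<and> (\<forall>i<n. y i < y (Suc i))"
proof -
  have "\<exists>y. z i < y \<and> y < z (Suc i) \<and> f' y = 0" if "i \<le> n" for i
  proof -
    have zi: "z i \<in> {\<alpha>..\<beta>}" "z (Suc i) \<in> {\<alpha>..\<beta>}" "f (z i) = 0" "f (z (Suc i)) = 0"
      using z[of i] z[of "Suc i"] that by auto
    have "\<exists>y. z i < y \<and> y < z (Suc i) \<and> (*) (f' y) = (\<lambda>v. 0)"
    proof (rule Rolle_deriv[of _ _ f])
      show "z i < z (Suc i)" by (rule less[OF that])
      show "f (z i) = f (z (Suc i))" using zi by simp
      show "continuous_on {z i..z (Suc i)} f"
        by (rule continuous_on_subset[OF DERIV_continuous_on[OF der]]) (use zi in auto)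
    next
      fix x assume x: "z i < x" "x < z (Suc i)"
      then have x': "\<alpha> < x" "x < \<beta>" using zi by auto
      have "(f has_real_derivative f' x) (at x)"
        using der[of x] x' by (simp add: at_within_Icc_at)
      then show "(f has_derivative (*) (f' x)) (at x)"
        by (simp add: has_field_derivative_def)
    qed
    then obtain y where "z i < y" "y < z (Suc i)" "(*) (f' y) = (\<lambda>v. 0)" by blast
    moreover from this(3) have "f' y = 0" by (metis mult.right_neutral)
    ultimately show ?thesis by blast
  qed
  then obtain y where y: "\<And>i. i \<le> n \<Longrightarrow> z i < y i \<and> y i < z (Suc i) \<and> f' (y i) = 0" by metis
  have "y i \<in> {\<alpha>..\<beta>}" if "i \<le> n" for i
    using y[OF that] z[of i] z[of "Suc i"] that by auto
  moreover have "y i < y (Suc i)" if "i < n" for i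
    using y[of i] y[of "Suc i"] that by auto
  ultimately show ?thesis using y by blast
qed

text \<open>Each differentiation costs one of the n + 1 zeros, so one remains for
  \<open>D n\<close>. Passing the derivatives as a family \<open>D\<close> allows derivatives
  relative to a closed interval.\<close>

lemma generalized_Rolle_seq:
  fixes D :: "nat \<Rightarrow> real \<Rightarrow> real" and z :: "nat \<Rightarrow> real"
  assumes "\<And>k x. k < n \<Longrightarrow> x \<in> {\<alpha>..\<beta>} \<Longrightarrow>
             (D k has_real_derivative D (Suc k) x) (at x within {\<alpha>..\<beta>})"
    and "\<And>i. i \<le> n \<Longrightarrow> z i \<in> {\<alpha>..\<beta>} \<and> D 0 (z i) = 0"
    and "\<And>i. i < n \<Longrightarrow> z i < z (Suc i)"
  shows "\<exists>\<zeta>\<in>{\<alpha>..\<beta>}. D n \<zeta> = 0"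
  using assms
proof (induction n arbitrary: D z)
  case 0
  then show ?case by auto
next
  case (Suc n)
  have "\<exists>y. (\<forall>i\<le>n. y i \<in> {\<alpha>..\<beta>} \<and> D (Suc 0) (y i) = 0) \<and> (\<forall>i<n. y i < y (Suc i))"
    by (rule zeros_of_derivative_between[of \<alpha> \<beta> "D 0" _ n z])
      (use Suc.prems in \<open>auto simp: less_Suc_eq_le\<close>)
  then obtain y where "\<forall>i\<le>n. y i \<in> {\<alpha>..\<beta>} \<and> D (Suc 0) (y i) = 0" "\<forall>i<n. y i < y (Suc i)"
    by blast
  then show ?case
    using Suc.IH[of "\<lambda>k. D (Suc k)" y] Suc.prems(1) by auto
qed

lemma generalized_Rolle:
  fixes D :: "nat \<Rightarrow> real \<Rightarrow> real"
  assumes der: "\<And>k x. k < n \<Longrightarrow> x \<in> {\<alpha>..\<beta>} \<Longrightarrow>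
             (D k has_real_derivative D (Suc k) x) (at x within {\<alpha>..\<beta>})"
    and Z: "Z \<subseteq> {\<alpha>..\<beta>}" "card Z = Suc n" "\<And>x. x \<in> Z \<Longrightarrow> D 0 x = 0"
  shows "\<exists>\<zeta>\<in>{\<alpha>..\<beta>}. D n \<zeta> = 0"
proof (rule generalized_Rolle_seq[where z = "\<lambda>i. sorted_list_of_set Z ! i"])
  have fin: "finite Z" using Z(2) card.infinite by fastforce
  have len: "length (sorted_list_of_set Z) = Suc n" using Z(2) by simp
  have "sorted_list_of_set Z ! i \<in> Z" if "i \<le> n" for i
    using nth_mem[of i "sorted_list_of_set Z"] len that fin by simp
  then show "sorted_list_of_set Z ! i \<in> {\<alpha>..\<beta>} \<and> D 0 (sorted_list_of_set Z ! i) = 0"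
    if "i \<le> n" for i
    using Z that by blast
  show "sorted_list_of_set Z ! i < sorted_list_of_set Z ! Suc i" if "i < n" for i
    using sorted_wrt_nth_less[OF strict_sorted_list_of_set, of i "Suc i" Z] len that by simp
qed (use der in auto)

text \<open>Cauchy's remainder formula: a multiple of the node polynomial is added to
  \<open>q\<close> so that the difference from \<open>D 0\<close> vanishes at \<open>x\<close> too;
  these r + 2 zeros leave one zero of the derivative of order r + 1.\<close>

lemma interpolation_error:
  fixes D :: "nat \<Rightarrow> real \<Rightarrow> real" and q :: "real poly"
  assumes der: "\<And>k x. k < Suc r \<Longrightarrow> x \<in> {\<alpha>..\<beta>} \<Longrightarrow>
             (D k has_real_derivative D (Suc k) x) (at x within {\<alpha>..\<beta>})"
    and c: "inj_on c {0..r}" "c ` {0..r} \<subseteq> {\<alpha>..\<beta>}"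
    and q: "degree q \<le> r" "\<And>k. k \<in> {0..r} \<Longrightarrow> poly q (c k) = D 0 (c k)"
    and x: "x \<in> {\<alpha>..\<beta>}"
  shows "\<exists>\<zeta>\<in>{\<alpha>..\<beta>}. D 0 x - poly q x = D (Suc r) \<zeta> / fact (Suc r) * (\<Prod>k=0..r. x - c k)"
proof (cases "x \<in> c ` {0..r}")
  case True
  then obtain k where k: "k \<in> {0..r}" "x = c k" by auto
  then have "(\<Prod>k=0..r. x - c k) = 0" by (intro prod_zero) auto
  then show ?thesis using q(2)[OF k(1)] k x by auto
next
  case False
  define w where "w = (\<Prod>k=0..r. [:- c k, 1:])"
  have w: "poly w y = (\<Prod>k=0..r. y - c k)" for y by (simp add: w_def poly_prod)
  have degw: "degree w = Suc r" unfolding w_def by (subst degree_prod_sum_eq) auto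
  have "lead_coeff w = 1" unfolding w_def by (subst lead_coeff_prod) auto
  then have cw: "coeff w (Suc r) = 1" using degw by simp
  have wx: "poly w x \<noteq> 0" using False by (auto simp: w)
  \<comment> \<open>Chosen so that \<open>P\<close> agrees with \<open>D 0\<close> at
    \<open>x\<close>; at the nodes \<open>w\<close> vanishes and the agreement of \<open>q\<close>
    is kept.\<close>
  define K where "K = (D 0 x - poly q x) / poly w x"
  define P where "P = q + smult K w"
  have "\<exists>\<zeta>\<in>{\<alpha>..\<beta>}. D (Suc r) \<zeta> - poly ((pderiv ^^ Suc r) P) \<zeta> = 0"
  proof (rule generalized_Rolle[where D = "\<lambda>k y. D k y - poly ((pderiv ^^ k) P) y"])
    show "insert x (c ` {0..r}) \<subseteq> {\<alpha>..\<beta>}" using c x by auto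
    show "card (insert x (c ` {0..r})) = Suc (Suc r)"
      using False c(1) by (simp add: card_image)
    show "D 0 y - poly ((pderiv ^^ 0) P) y = 0" if y: "y \<in> insert x (c ` {0..r})" for y
    proof (cases "y = x")
      case True
      then show ?thesis using wx by (simp add: P_def K_def)
    next
      case False
      then obtain k where k: "k \<in> {0..r}" "y = c k" using y by auto
      then have "poly w y = 0" unfolding w by (intro prod_zero) auto
      then show ?thesis using q(2)[OF k(1)] k by (simp add: P_def)
    qed
  next
    fix k y assume "k < Suc r" "y \<in> {\<alpha>..\<beta>}"
    then show "((\<lambda>y. D k y - poly ((pderiv ^^ k) P) y) has_real_derivative
        D (Suc k) y - poly ((pderiv ^^ Suc k) P) y) (at y within {\<alpha>..\<beta>})"
      using der by (auto intro!: derivative_eq_intros has_field_derivative_at_within[OF poly_DERIV])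
  qed
  then obtain \<zeta> where \<zeta>: "\<zeta> \<in> {\<alpha>..\<beta>}" "D (Suc r) \<zeta> = poly ((pderiv ^^ Suc r) P) \<zeta>" by auto
  \<comment> \<open>\<open>P\<close> has degree at most r + 1 with coefficient \<open>K\<close>
    there, because \<open>q\<close> has smaller degree and \<open>w\<close> is monic.\<close>
  have "(pderiv ^^ Suc r) P = [:K * fact (Suc r):]"
  proof (rule poly_eqI)
    fix n
    have "coeff P (n + Suc r) = (if n = 0 then K else 0)"
      using q(1) degw cw by (auto simp: P_def coeff_eq_0)
    then show "coeff ((pderiv ^^ Suc r) P) n = coeff [:K * fact (Suc r):] n"
      unfolding coeff_higher_pderiv by (cases n) (auto simp: pochhammer_fact)
  qed
  then have "D (Suc r) \<zeta> = K * fact (Suc r)" using \<zeta>(2) by simp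
  then have "D 0 x - poly q x = D (Suc r) \<zeta> / fact (Suc r) * poly w x"
    using wx by (simp add: K_def del: fact_Suc)
  then show ?thesis using \<zeta>(1) w by auto
qed

section \<open>Chebyshev polynomials of the first kind and the size of the node polynomial\<close>

fun chebyshev_poly :: "nat \<Rightarrow> real poly" where
  "chebyshev_poly 0 = 1"
| "chebyshev_poly (Suc 0) = [:0, 1:]"
| "chebyshev_poly (Suc (Suc n)) = [:0, 2:] * chebyshev_poly (Suc n) - chebyshev_poly n"

lemma poly_chebyshev_poly_cos: "poly (chebyshev_poly n) (cos t) = cos (real n * t)"
proof (induction n rule: chebyshev_poly.induct)
  case (3 n)
  have "cos (real (Suc (Suc n)) * t) + cos (real n * t) = 2 * cos t * cos (real (Suc n) * t)"
    using cos_add[of "real (Suc n) * t" t] cos_diff[of "real (Suc n) * t" t]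
    by (simp add: algebra_simps)
  then show ?case using 3 by simp
qed auto

text \<open>Proved together: in the recurrence the degree bound for \<open>chebyshev_poly k\<close>
  removes it from the top coefficient, which therefore doubles.\<close>

lemma chebyshev_poly_degree_coeff:
  "degree (chebyshev_poly n) \<le> n \<and> coeff (chebyshev_poly (Suc n)) (Suc n) = 2 ^ n"
proof (induction n rule: less_induct)
  case (less n)
  have step: "chebyshev_poly (Suc (Suc k))
      = smult 2 (pCons 0 (chebyshev_poly (Suc k))) - chebyshev_poly k" for k
    by simp
  have deg: "degree (chebyshev_poly n) \<le> n"
  proof (cases n rule: chebyshev_poly.cases)
    case (3 k)
    have "degree (smult 2 (pCons 0 (chebyshev_poly (Suc k)))) \<le> n"
      using less[of "Suc k"] 3 by (intro order.trans[OF degree_smult_le] order.trans[OF degree_pCons_le]) auto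
    moreover have "degree (chebyshev_poly k) \<le> n" using less[of k] 3 by simp
    ultimately show ?thesis unfolding 3 step by (intro degree_diff_le) (use 3 in auto)
  qed auto
  show ?case
  proof (cases n)
    case (Suc k)
    have "coeff (chebyshev_poly k) (Suc (Suc k)) = 0"
      using less[of k] Suc by (intro coeff_eq_0) auto
    then show ?thesis using deg less[of k] Suc unfolding Suc step by simp
  qed (use deg in auto)
qed

lemma cos_chebyshev_angles_inj:
  "inj_on (\<lambda>k. cos (real (2 * k + 1) / real (2 * r + 2) * pi)) {0..r}"
proof (rule inj_onI)
  fix k l assume "k \<in> {0..r}" "l \<in> {0..r}"
    and eq: "cos (real (2 * k + 1) / real (2 * r + 2) * pi) = cos (real (2 * l + 1) / real (2 * r + 2) * pi)"
  have "0 \<le> real (2 * j + 1) / real (2 * r + 2) * pi \<and> real (2 * j + 1) / real (2 * r + 2) * pi \<le> pi"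
    if "j \<in> {0..r}" for j
  proof -
    have "real (2 * j + 1) / real (2 * r + 2) \<le> 1" using that by simp
    from mult_right_mono[OF this pi_ge_zero] show ?thesis by simp
  qed
  then have "real (2 * k + 1) / real (2 * r + 2) * pi = real (2 * l + 1) / real (2 * r + 2) * pi"
    using cos_inj_pi eq \<open>k \<in> {0..r}\<close> \<open>l \<in> {0..r}\<close> by blast
  then show "k = l" by (simp add: divide_simps)
qed

lemma cos_odd_multiple_half_pi: "cos (real (2 * k + 1) * pi / 2) = 0"
proof -
  have "real (2 * k + 1) * pi / 2 = real_of_int (2 * int k + 1) * (pi / 2)" by simp
  moreover have "odd (2 * int k + 1)" by simp
  ultimately show ?thesis unfolding cos_zero_iff_int by blast
qed

text \<open>Both sides have degree at most r + 1, the same coefficient there, and vanish at r + 1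
  distinct cosines, where the left side is the cosine of an odd multiple of pi/2.\<close>

lemma chebyshev_poly_factorization:
  "chebyshev_poly (Suc r) =
     smult (2 ^ r) (\<Prod>k=0..r. [:- cos (real (2 * k + 1) / real (2 * r + 2) * pi), 1:])"
    (is "_ = smult _ ?w")
proof (rule poly_eqI_degree_lead_coeff[where n = "Suc r" and
      A = "(\<lambda>k. cos (real (2 * k + 1) / real (2 * r + 2) * pi)) ` {0..r}"])
  have degw: "degree ?w = Suc r" by (subst degree_prod_sum_eq) auto
  have "lead_coeff ?w = 1" by (subst lead_coeff_prod) auto
  then have "coeff ?w (Suc r) = 1" using degw by simp
  then show "coeff (chebyshev_poly (Suc r)) (Suc r) = coeff (smult (2 ^ r) ?w) (Suc r)"
    using chebyshev_poly_degree_coeff[of r] by simp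
  show "degree (smult (2 ^ r) ?w) \<le> Suc r" using degw by simp
  show "degree (chebyshev_poly (Suc r)) \<le> Suc r" using chebyshev_poly_degree_coeff by blast
  show "Suc r \<le> card ((\<lambda>k. cos (real (2 * k + 1) / real (2 * r + 2) * pi)) ` {0..r})"
    by (subst card_image[OF cos_chebyshev_angles_inj]) simp
next
  fix z assume "z \<in> (\<lambda>k. cos (real (2 * k + 1) / real (2 * r + 2) * pi)) ` {0..r}"
  then obtain k where k: "k \<in> {0..r}" "z = cos (real (2 * k + 1) / real (2 * r + 2) * pi)" by auto
  have "real (Suc r) * (real (2 * k + 1) / real (2 * r + 2) * pi) = real (2 * k + 1) * pi / 2"
    by (simp add: divide_simps)
  then have "poly (chebyshev_poly (Suc r)) z = 0"
    unfolding k(2) poly_chebyshev_poly_cos by (simp only: cos_odd_multiple_half_pi)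
  moreover have "poly ?w z = 0"
    unfolding poly_prod using k by (intro prod_zero) auto
  ultimately show "poly (chebyshev_poly (Suc r)) z = poly (smult (2 ^ r) ?w) z" by simp
qed

text \<open>Up to the factor 2^r the product is the Chebyshev polynomial of degree r + 1, which on
  [-1, 1] is the cosine of (r + 1) arccos y.\<close>

lemma chebyshev_node_product_le:
  assumes "\<bar>y\<bar> \<le> 1"
  shows "\<bar>\<Prod>k=0..r. y - cos (real (2 * k + 1) / real (2 * r + 2) * pi)\<bar> \<le> 1 / 2 ^ r"
proof -
  have "2 ^ r * (\<Prod>k=0..r. y - cos (real (2 * k + 1) / real (2 * r + 2) * pi))
      = poly (chebyshev_poly (Suc r)) y"
    unfolding chebyshev_poly_factorization by (simp add: poly_prod)
  also have "\<dots> = cos (real (Suc r) * arccos y)"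
    using poly_chebyshev_poly_cos[of "Suc r" "arccos y"] assms by (simp add: abs_le_iff)
  finally have eq: "2 ^ r * (\<Prod>k=0..r. y - cos (real (2 * k + 1) / real (2 * r + 2) * pi))
      = cos (real (Suc r) * arccos y)" .
  have "2 ^ r * \<bar>\<Prod>k=0..r. y - cos (real (2 * k + 1) / real (2 * r + 2) * pi)\<bar> \<le> 1"
    using abs_cos_le_one[of "real (Suc r) * arccos y"] unfolding eq[symmetric] abs_mult by simp
  then show ?thesis by (simp add: field_simps)
qed

section \<open>Operators preserving a cone of log-Lipschitz functions\<close>

text \<open>The condition of \<open>log_lip_cone\<close> freed from extensionality, so that
  pointwise combinations can be written without restricting them to \<open>T\<close>.\<close>

definition log_lip_on :: "real \<Rightarrow> real set \<Rightarrow> (real \<Rightarrow> real) \<Rightarrow> bool" where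
  "log_lip_on M T F \<longleftrightarrow> (\<forall>\<xi>\<in>T. \<forall>\<eta>\<in>T. F \<xi> \<le> exp (M * \<bar>\<xi> - \<eta>\<bar>) * F \<eta>)"

text \<open>The value type is left open so that one matrix acts on real functions and, for the
  spectrum, on complex ones.\<close>

definition mat_app :: "real set \<Rightarrow> (real \<Rightarrow> real \<Rightarrow> real) \<Rightarrow> (real \<Rightarrow> 'b::real_normed_vector) \<Rightarrow> real \<Rightarrow> 'b" where
  "mat_app T B F = (\<lambda>\<xi>. \<Sum>\<eta>\<in>T. B \<xi> \<eta> *\<^sub>R F \<eta>)"

lemma log_lip_on_cong:
  "(\<And>\<xi>. \<xi> \<in> T \<Longrightarrow> F \<xi> = F' \<xi>) \<Longrightarrow> log_lip_on M T F \<longleftrightarrow> log_lip_on M T F'"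
  by (simp add: log_lip_on_def)

lemma log_lip_on_add:
  "log_lip_on M T F \<Longrightarrow> log_lip_on M T F' \<Longrightarrow> log_lip_on M T (\<lambda>x. F x + F' x)"
  unfolding log_lip_on_def by (auto simp: distrib_left intro!: add_mono)

lemma log_lip_on_scale:
  assumes "c \<ge> 0" "log_lip_on M T F"
  shows "log_lip_on M T (\<lambda>x. c * F x)"
  using assms mult_left_mono[OF _ \<open>c \<ge> 0\<close>] unfolding log_lip_on_def
  by (metis mult.left_commute)

text \<open>Going to \<eta> and back gives F \<xi> \<le> e^2 F \<xi> with e > 1. On a single point
  the cone condition would be empty.\<close>

lemma log_lip_on_nonneg:
  assumes F: "log_lip_on M T F" and "M > 0" "\<xi> \<in> T" "\<eta> \<in> T" "\<xi> \<noteq> \<eta>"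
  shows "F \<xi> \<ge> 0"
proof -
  define e where "e = exp (M * \<bar>\<xi> - \<eta>\<bar>)"
  have "M * \<bar>\<xi> - \<eta>\<bar> > 0" using assms by simp
  then have e: "e > 1" unfolding e_def by simp
  have "F \<xi> \<le> e * F \<eta>" "F \<eta> \<le> e * F \<xi>"
    using F assms unfolding log_lip_on_def e_def by (auto simp: abs_minus_commute)
  then have "F \<xi> \<le> e * (e * F \<xi>)"
    using mult_left_mono[of "F \<eta>" "e * F \<xi>" e] e by linarith
  then have "0 \<le> (e * e - 1) * F \<xi>" by (simp add: algebra_simps)
  moreover have "e * e - 1 > 0" using e mult_strict_mono[of 1 e 1 e] by simp
  ultimately show ?thesis by (simp add: zero_le_mult_iff)
qed

lemma log_lip_on_mono:
  assumes "log_lip_on M T F" "M \<le> M'" "\<And>\<xi>. \<xi> \<in> T \<Longrightarrow> F \<xi> \<ge> 0"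
  shows "log_lip_on M' T F"
  unfolding log_lip_on_def
proof (intro ballI)
  fix \<xi> \<eta> assume *: "\<xi> \<in> T" "\<eta> \<in> T"
  have "F \<xi> \<le> exp (M * \<bar>\<xi> - \<eta>\<bar>) * F \<eta>" using assms * unfolding log_lip_on_def by blast
  also have "\<dots> \<le> exp (M' * \<bar>\<xi> - \<eta>\<bar>) * F \<eta>"
    using assms * by (intro mult_right_mono) (auto intro!: mult_right_mono)
  finally show "F \<xi> \<le> exp (M' * \<bar>\<xi> - \<eta>\<bar>) * F \<eta>" .
qed

lemma log_lip_on_pos:
  assumes F: "log_lip_on M T F" and "\<xi> \<in> T" "\<eta> \<in> T" "F \<eta> > 0"
  shows "F \<xi> > 0"
proof -
  have "F \<eta> \<le> exp (M * \<bar>\<eta> - \<xi>\<bar>) * F \<xi>" using assms unfolding log_lip_on_def by blast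
  then have "0 < exp (M * \<bar>\<eta> - \<xi>\<bar>) * F \<xi>" using assms by linarith
  then show ?thesis by (simp add: zero_less_mult_iff)
qed

text \<open>A positive function of the smaller cone is an order unit for the larger one.\<close>

lemma log_lip_on_interior:
  assumes fin: "finite T" and M: "M' < M" and V: "log_lip_on M' T V"
    and pos: "\<And>\<xi>. \<xi> \<in> T \<Longrightarrow> V \<xi> > 0"
  shows "\<exists>\<epsilon>>0. \<forall>F c. (\<forall>\<eta>\<in>T. \<bar>F \<eta>\<bar> \<le> c) \<longrightarrow> log_lip_on M T (\<lambda>x. c * V x + \<epsilon> * F x)"
proof -
  let ?e = "\<lambda>\<xi> \<eta>. exp (M * \<bar>\<xi> - \<eta>\<bar>)"
  have "\<forall>\<^sub>F \<epsilon> in at_right 0. \<forall>\<xi>\<in>T. \<forall>\<eta>\<in>T. \<xi> \<noteq> \<eta> \<longrightarrow> \<epsilon> * (1 + ?e \<xi> \<eta>) < ?e \<xi> \<eta> * V \<eta> - V \<xi>"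
  proof (intro eventually_ball_finite[OF fin] ballI)
    fix \<xi> \<eta> assume *: "\<xi> \<in> T" "\<eta> \<in> T"
    show "\<forall>\<^sub>F \<epsilon> in at_right 0. \<xi> \<noteq> \<eta> \<longrightarrow> \<epsilon> * (1 + ?e \<xi> \<eta>) < ?e \<xi> \<eta> * V \<eta> - V \<xi>"
    proof (cases "\<xi> = \<eta>")
      case False
      \<comment> \<open>M' < M leaves a positive gap for each pair of distinct points; the pairs are
        finitely many, so one small \<epsilon> fits into all gaps.\<close>
      have "V \<xi> \<le> exp (M' * \<bar>\<xi> - \<eta>\<bar>) * V \<eta>" using V * unfolding log_lip_on_def by blast
      also have "\<dots> < ?e \<xi> \<eta> * V \<eta>"
        using False M pos[OF *(2)] by (intro mult_strict_right_mono) auto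
      finally have "0 < ?e \<xi> \<eta> * V \<eta> - V \<xi>" by simp
      moreover have "((\<lambda>\<epsilon>::real. \<epsilon> * (1 + ?e \<xi> \<eta>)) \<longlongrightarrow> 0 * (1 + ?e \<xi> \<eta>)) (at_right 0)"
        by (intro tendsto_intros)
      ultimately show ?thesis using order_tendstoD(2) by fastforce
    qed simp
  qed
  moreover have "\<forall>\<^sub>F \<epsilon> in at_right (0::real). 0 < \<epsilon>" by (simp add: eventually_at_right_less)
  ultimately have "\<forall>\<^sub>F \<epsilon> in at_right (0::real). 0 < \<epsilon> \<and>
      (\<forall>\<xi>\<in>T. \<forall>\<eta>\<in>T. \<xi> \<noteq> \<eta> \<longrightarrow> \<epsilon> * (1 + ?e \<xi> \<eta>) < ?e \<xi> \<eta> * V \<eta> - V \<xi>)"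
    by eventually_elim auto
  then obtain \<epsilon> where \<epsilon>: "\<epsilon> > 0"
    "\<And>\<xi> \<eta>. \<xi> \<in> T \<Longrightarrow> \<eta> \<in> T \<Longrightarrow> \<xi> \<noteq> \<eta> \<Longrightarrow> \<epsilon> * (1 + ?e \<xi> \<eta>) < ?e \<xi> \<eta> * V \<eta> - V \<xi>"
    using eventually_happens'[OF trivial_limit_at_right_real[of 0]] by blast
  have "log_lip_on M T (\<lambda>x. c * V x + \<epsilon> * F x)" if F: "\<forall>\<eta>\<in>T. \<bar>F \<eta>\<bar> \<le> c" for F c
    unfolding log_lip_on_def
  proof (intro ballI)
    fix \<xi> \<eta> assume *: "\<xi> \<in> T" "\<eta> \<in> T"
    show "c * V \<xi> + \<epsilon> * F \<xi> \<le> ?e \<xi> \<eta> * (c * V \<eta> + \<epsilon> * F \<eta>)"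
    proof (cases "\<xi> = \<eta>")
      case False
      have c: "c \<ge> 0" using F *(1) by fastforce
      \<comment> \<open>Worst case: \<open>F\<close> is \<open>c\<close> at \<xi> and
        \<open>-c\<close> at \<eta>.\<close>
      have "\<epsilon> * (F \<xi> + ?e \<xi> \<eta> * (- F \<eta>)) \<le> \<epsilon> * (c + ?e \<xi> \<eta> * c)"
        using F * \<epsilon>(1) by (intro mult_left_mono add_mono) (auto simp: abs_le_iff intro: order.trans)
      also have "\<dots> = c * (\<epsilon> * (1 + ?e \<xi> \<eta>))" by (simp add: algebra_simps)
      also have "\<dots> \<le> c * (?e \<xi> \<eta> * V \<eta> - V \<xi>)"
        using \<epsilon>(2)[OF * False] c by (intro mult_left_mono) auto
      finally show ?thesis by (simp add: algebra_simps)
    qed simp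
  qed
  then show ?thesis using \<epsilon>(1) by blast
qed

text \<open>With y the quotient on the left, ln y \<le> sinh (ln y) = (y - 1/y)/2, which equals the
  exponent on the right.\<close>

lemma one_plus_over_one_minus_le_exp:
  fixes x :: real
  assumes "0 \<le> x" "x < 1"
  shows "(1 + x) / (1 - x) \<le> exp (2 * x / (1 - x\<^sup>2))"
proof -
  define y where "y = (1 + x) / (1 - x)"
  have y: "y \<ge> 1" using assms by (simp add: y_def field_simps)
  have "ln y \<le> (exp (ln y) - inverse (exp (ln y))) / 2"
    by (rule real_le_x_sinh) (use y in simp)
  also have "\<dots> = (y - inverse y) / 2" using y by simp
  also have "\<dots> = 2 * x / (1 - x\<^sup>2)"
  proof -
    have "1 - x\<^sup>2 = (1 + x) * (1 - x)" by (simp add: power2_eq_square algebra_simps)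
    moreover have "(y - inverse y) / 2 = 2 * x / ((1 + x) * (1 - x))"
      using assms by (simp add: y_def divide_simps) (simp add: algebra_simps)
    ultimately show ?thesis by simp
  qed
  finally have "exp (ln y) \<le> exp (2 * x / (1 - x\<^sup>2))" by (simp only: exp_le_cancel_iff)
  moreover have "exp (ln y) = y" using y by simp
  ultimately show ?thesis by (simp only: y_def)
qed

text \<open>The perturbation changes a quotient of two values by at most the factor (1 +
  \<epsilon>)/(1 - \<epsilon>). Distinct points are at least \<open>d\<close> apart, so a larger
  exponent rate absorbs this fixed factor.\<close>

lemma log_lip_on_perturb:
  assumes W: "log_lip_on A T W" and W0: "\<And>\<xi>. \<xi> \<in> T \<Longrightarrow> W \<xi> \<ge> 0"
    and eps: "0 \<le> \<epsilon>" "\<epsilon> < 1"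
    and close: "\<And>\<xi>. \<xi> \<in> T \<Longrightarrow> \<bar>U \<xi> - W \<xi>\<bar> \<le> \<epsilon> * W \<xi>"
    and d: "d > 0" "\<And>\<xi> \<eta>. \<xi> \<in> T \<Longrightarrow> \<eta> \<in> T \<Longrightarrow> \<xi> \<noteq> \<eta> \<Longrightarrow> d \<le> \<bar>\<xi> - \<eta>\<bar>"
  shows "log_lip_on (A + 2 * \<epsilon> / ((1 - \<epsilon>\<^sup>2) * d)) T U"
  unfolding log_lip_on_def
proof (intro ballI)
  fix \<xi> \<eta> assume *: "\<xi> \<in> T" "\<eta> \<in> T"
  let ?D = "2 * \<epsilon> / ((1 - \<epsilon>\<^sup>2) * d)"
  show "U \<xi> \<le> exp ((A + ?D) * \<bar>\<xi> - \<eta>\<bar>) * U \<eta>"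
  proof (cases "\<xi> = \<eta>")
    case False
    have e2: "1 - \<epsilon>\<^sup>2 > 0" using eps by (simp add: power_less_one_iff abs_square_less_1)
    have U: "U \<xi> \<le> (1 + \<epsilon>) * W \<xi>" "(1 - \<epsilon>) * W \<eta> \<le> U \<eta>" 
      using close[OF *(1)] close[OF *(2)] by (auto simp: algebra_simps abs_le_iff)
    have W': "W \<eta> \<le> U \<eta> / (1 - \<epsilon>)" using U(2) eps by (simp add: field_simps)
    have U0: "U \<eta> \<ge> 0"
      using U(2) W0[OF *(2)] eps by (meson diff_ge_0_iff_ge less_imp_le mult_nonneg_nonneg order.trans)
    have "U \<xi> \<le> (1 + \<epsilon>) * (exp (A * \<bar>\<xi> - \<eta>\<bar>) * (U \<eta> / (1 - \<epsilon>)))"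
    proof -
      have "W \<xi> \<le> exp (A * \<bar>\<xi> - \<eta>\<bar>) * W \<eta>" using W * unfolding log_lip_on_def by blast
      also have "\<dots> \<le> exp (A * \<bar>\<xi> - \<eta>\<bar>) * (U \<eta> / (1 - \<epsilon>))"
        using W' by (rule mult_left_mono) simp
      finally show ?thesis using U(1) eps mult_left_mono by (smt (verit))
    qed
    also have "\<dots> = (1 + \<epsilon>) / (1 - \<epsilon>) * (exp (A * \<bar>\<xi> - \<eta>\<bar>) * U \<eta>)" by simp
    also have "\<dots> \<le> exp (?D * \<bar>\<xi> - \<eta>\<bar>) * (exp (A * \<bar>\<xi> - \<eta>\<bar>) * U \<eta>)"
    proof (rule mult_right_mono)
      have "(1 + \<epsilon>) / (1 - \<epsilon>) \<le> exp (2 * \<epsilon> / (1 - \<epsilon>\<^sup>2))" using eps by (rule one_plus_over_one_minus_le_exp)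
      also have "2 * \<epsilon> / (1 - \<epsilon>\<^sup>2) = ?D * d" using d by simp
      also have "\<dots> \<le> ?D * \<bar>\<xi> - \<eta>\<bar>"
        using d(2)[OF * False] eps e2 d(1) by (intro mult_left_mono) auto
      finally show "(1 + \<epsilon>) / (1 - \<epsilon>) \<le> exp (?D * \<bar>\<xi> - \<eta>\<bar>)" by simp
    qed (use U0 in simp)
    also have "\<dots> = exp ((A + ?D) * \<bar>\<xi> - \<eta>\<bar>) * U \<eta>"
      by (simp add: exp_add[symmetric] algebra_simps)
    finally show ?thesis .
  qed simp
qed

section \<open>Linearity of the matrix action and of its powers\<close>

lemma mat_app_add: "mat_app T B (\<lambda>x. F x + F' x) = (\<lambda>\<xi>. mat_app T B F \<xi> + mat_app T B F' \<xi>)"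
  by (simp add: mat_app_def scaleR_add_right sum.distrib)

lemma mat_app_linear:
  assumes "linear L"
  shows "mat_app T B (\<lambda>x. L (F x)) = (\<lambda>\<xi>. L (mat_app T B F \<xi>))"
  by (simp add: mat_app_def linear_sum[OF assms] linear_scale[OF assms])

lemma mat_app_funpow_add:
  "(mat_app T B ^^ k) (\<lambda>x. F x + F' x) = (\<lambda>\<xi>. (mat_app T B ^^ k) F \<xi> + (mat_app T B ^^ k) F' \<xi>)"
  by (induction k) (simp_all add: mat_app_add)

lemma mat_app_funpow_linear:
  assumes "linear L"
  shows "(mat_app T B ^^ k) (\<lambda>x. L (F x)) = (\<lambda>\<xi>. L ((mat_app T B ^^ k) F \<xi>))"
  by (induction k) (simp_all add: mat_app_linear[OF assms])

lemma mat_app_cong: "(\<And>\<xi>. \<xi> \<in> T \<Longrightarrow> F \<xi> = F' \<xi>) \<Longrightarrow> mat_app T B F = mat_app T B F'"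
  by (simp add: mat_app_def)

lemma linear_mult_left: "linear (\<lambda>x::'a::real_normed_algebra. c * x)"
  by (simp add: bounded_linear.linear bounded_linear_mult_right)

lemmas mat_app_scale = mat_app_linear[OF linear_mult_left]
lemmas mat_app_funpow_scale = mat_app_funpow_linear[OF linear_mult_left]

text \<open>The abstract setting of the spectral argument. \<open>two\<close> makes the elements of
  both cones nonnegative; \<open>inv\<close> with M' < M sends the large cone into the smaller one,
  whose positive elements are order units of the large one.\<close>

locale cone_preserving =
  fixes T :: "real set" and B :: "real \<Rightarrow> real \<Rightarrow> real" and M M' :: real
  assumes fin: "finite T" and two: "\<And>\<xi>. \<xi> \<in> T \<Longrightarrow> \<exists>\<eta>\<in>T. \<xi> \<noteq> \<eta>" and ne: "T \<noteq> {}"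
    and M': "0 < M'" "M' < M"
    and inv: "\<And>F. log_lip_on M T F \<Longrightarrow> log_lip_on M' T (mat_app T B F)"
begin

abbreviation A :: "(real \<Rightarrow> 'b::real_normed_vector) \<Rightarrow> real \<Rightarrow> 'b" where "A \<equiv> mat_app T B"

lemma nonneg: "log_lip_on M T F \<Longrightarrow> \<xi> \<in> T \<Longrightarrow> F \<xi> \<ge> 0"
  using two log_lip_on_nonneg[of M T F] M' by (meson order.strict_trans)

lemma nonneg': "log_lip_on M' T F \<Longrightarrow> \<xi> \<in> T \<Longrightarrow> F \<xi> \<ge> 0"
  using two log_lip_on_nonneg[of M' T F] M' by meson

lemma weaken: "log_lip_on M' T F \<Longrightarrow> log_lip_on M T F"
  using log_lip_on_mono nonneg' M' by (meson less_imp_le)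

lemma inv_funpow: "log_lip_on M T F \<Longrightarrow> log_lip_on M T ((A ^^ k) F)"
  by (induction k) (auto intro: weaken inv)

text \<open>Induction by c^(k+1) V - A^(k+1) V = A (c^k V - A^k V) + c^k (c V - A V), where both
  summands lie in the cone.\<close>

lemma funpow_le:
  assumes "c \<ge> 0" and sub: "log_lip_on M T (\<lambda>\<xi>. c * V \<xi> - A V \<xi>)"
  shows "log_lip_on M T (\<lambda>\<xi>. c ^ k * V \<xi> - (A ^^ k) V \<xi>)"
proof (induction k)
  case 0
  then show ?case by (simp add: log_lip_on_def)
next
  case (Suc k)
  have "log_lip_on M T (A (\<lambda>\<xi>. c ^ k * V \<xi> - (A ^^ k) V \<xi>))" using Suc inv weaken by blast
  moreover have "A (\<lambda>\<xi>. c ^ k * V \<xi> - (A ^^ k) V \<xi>) = (\<lambda>\<xi>. c ^ k * A V \<xi> - (A ^^ Suc k) V \<xi>)"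
    by (simp add: mat_app_def right_diff_distrib sum_subtractf sum_distrib_left algebra_simps)
  moreover have "log_lip_on M T (\<lambda>\<xi>. c ^ k * (c * V \<xi> - A V \<xi>))"
    using assms by (intro log_lip_on_scale) auto
  ultimately have "log_lip_on M T (\<lambda>\<xi>. (c ^ k * A V \<xi> - (A ^^ Suc k) V \<xi>) + c ^ k * (c * V \<xi> - A V \<xi>))"
    using log_lip_on_add by metis
  then show ?case by (simp add: algebra_simps)
qed

text \<open>As \<open>V\<close> is an order unit, \<open>s * V + \<epsilon> * F\<close> and the same
  with \<open>- F\<close> lie in the cone, and the powers of \<open>A\<close> keep them there.
  Nonnegativity of the images compares A^k F with A^k V, which \<open>funpow_le\<close>
  controls.\<close>

lemma funpow_bound:
  assumes "c \<ge> 0" and sub: "log_lip_on M T (\<lambda>\<xi>. c * V \<xi> - A V \<xi>)"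
    and V: "log_lip_on M'' T V" "M'' < M" and pos: "\<And>\<xi>. \<xi> \<in> T \<Longrightarrow> V \<xi> > 0"
  shows "\<exists>C\<ge>0. \<forall>k. \<forall>F s. (\<forall>\<eta>\<in>T. \<bar>F \<eta>\<bar> \<le> s) \<longrightarrow> (\<forall>\<xi>\<in>T. \<bar>(A ^^ k) F \<xi>\<bar> \<le> C * c ^ k * s)"
proof -
  obtain \<epsilon> where \<epsilon>: "\<epsilon> > 0"
    "\<And>F s. (\<forall>\<eta>\<in>T. \<bar>F \<eta>\<bar> \<le> s) \<Longrightarrow> log_lip_on M T (\<lambda>x. s * V x + \<epsilon> * F x)"
    using log_lip_on_interior[OF fin V(2) V(1) pos] by blast
  define C where "C = (\<Sum>\<xi>\<in>T. V \<xi>) / \<epsilon>"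
  have C: "V \<xi> \<le> C * \<epsilon>" if "\<xi> \<in> T" for \<xi>
  proof -
    have "V \<xi> \<le> (\<Sum>\<xi>\<in>T. V \<xi>)" by (intro member_le_sum) (use that pos fin in \<open>auto intro: less_imp_le\<close>)
    then show ?thesis using \<epsilon> by (simp add: C_def)
  qed
  have low: "- (C * c ^ k * s) \<le> (A ^^ k) F \<xi>" if F: "\<forall>\<eta>\<in>T. \<bar>F \<eta>\<bar> \<le> s" and \<xi>: "\<xi> \<in> T" for F s k \<xi>
  proof -
    have s: "s \<ge> 0" using F \<xi> by fastforce
    have "0 \<le> (A ^^ k) (\<lambda>x. s * V x + \<epsilon> * F x) \<xi>"
      using nonneg[OF inv_funpow[OF \<epsilon>(2)[OF F]] \<xi>] .
    then have "0 \<le> s * (A ^^ k) V \<xi> + \<epsilon> * (A ^^ k) F \<xi>"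
      by (simp add: mat_app_funpow_add mat_app_funpow_scale)
    moreover have "(A ^^ k) V \<xi> \<le> c ^ k * (C * \<epsilon>)"
      using nonneg[OF funpow_le[OF assms(1) sub, of k] \<xi>] mult_left_mono[OF C[OF \<xi>], of "c ^ k"] assms(1)
      by auto
    then have "s * (A ^^ k) V \<xi> \<le> s * (c ^ k * (C * \<epsilon>))" using s by (rule mult_left_mono)
    ultimately have "0 \<le> \<epsilon> * (C * c ^ k * s + (A ^^ k) F \<xi>)" by (simp add: algebra_simps)
    then show ?thesis using \<epsilon> by (simp add: zero_le_mult_iff)
  qed
  have "\<bar>(A ^^ k) F \<xi>\<bar> \<le> C * c ^ k * s" if F: "\<forall>\<eta>\<in>T. \<bar>F \<eta>\<bar> \<le> s" and \<xi>: "\<xi> \<in> T" for F s k \<xi>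
  proof -
    have "(A ^^ k) (\<lambda>x. - F x) \<xi> = - (A ^^ k) F \<xi>"
      using mat_app_funpow_scale[where c = "-1::real"] by simp
    then show ?thesis using low[OF F \<xi>, of k] low[of "\<lambda>x. - F x" s \<xi> k] F \<xi> by auto
  qed
  moreover have "C \<ge> 0" unfolding C_def
    using \<epsilon>(1) pos by (intro divide_nonneg_pos sum_nonneg) (auto intro: less_imp_le)
  ultimately show ?thesis by blast
qed

text \<open>
  Collatz--Wielandt argument. Among the normalised \<open>F\<close> in the smaller cone choose one with the
  largest \<open>\<rho>\<close> such that \<open>D = A F - \<rho> F\<close> lies in the cone. If \<open>A D\<close> did not vanish it would be an
  interior point, and \<open>A F\<close> would admit a larger \<open>\<rho>\<close>; hence \<open>A F\<close> (or \<open>F\<close>, if \<open>A F = 0\<close>) is an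
  eigenvector.
\<close>

lemma ex_eigenvalue_ge:
  assumes V: "log_lip_on M T V" and pos: "\<And>\<xi>. \<xi> \<in> T \<Longrightarrow> V \<xi> > 0"
    and sup: "log_lip_on M T (\<lambda>\<xi>. A V \<xi> - c * V \<xi>)"
  shows "\<exists>\<rho> F. \<rho> \<ge> c \<and> (\<exists>\<xi>\<in>T. F \<xi> \<noteq> 0) \<and> (\<forall>\<xi>\<in>T. A F \<xi> = \<rho> * F \<xi>)"
proof -
  obtain \<xi>0 where \<xi>0: "\<xi>0 \<in> T" using ne by blast
  \<comment> \<open>If \<open>A F\<close> vanishes, nonnegativity of \<open>- \<rho> * F\<close> at
    a point with F > 0 forces \<rho> \<le> 0, hence c \<le> 0, and 0 is a suitable
    eigenvalue.\<close>
  have zero: ?thesis if F: "log_lip_on M T F" "\<exists>\<xi>\<in>T. F \<xi> \<noteq> 0" "\<forall>\<xi>\<in>T. A F \<xi> = 0"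
      and \<rho>: "log_lip_on M T (\<lambda>\<xi>. A F \<xi> - \<rho> * F \<xi>)" "c \<le> \<rho>" for F \<rho>
  proof -
    obtain \<xi> where \<xi>: "\<xi> \<in> T" "F \<xi> \<noteq> 0" using F(2) by blast
    then have "F \<xi> > 0" using nonneg[OF F(1) \<xi>(1)] by simp
    moreover have "A F \<xi> - \<rho> * F \<xi> \<ge> 0" using nonneg[OF \<rho>(1) \<xi>(1)] .
    ultimately have "\<rho> \<le> 0" using F(3) \<xi>(1) by (simp add: mult_le_0_iff)
    then show ?thesis using F \<rho>(2) by (intro exI[of _ 0] exI[of _ F]) auto
  qed
  \<comment> \<open>Fixing the value 0 off \<open>T\<close> makes this set compact in the product
    topology on all functions, by Tychonoff; the conditions in \<open>Q\<close> are closed because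
    evaluations are continuous.\<close>
  define cube where "cube = (PiE UNIV (\<lambda>x::real. if x \<in> T then {0..1::real} else {0}))"
  \<comment> \<open>Caps \<rho>: for \<open>F\<close> with values in [0, 1] and sum 1, summing
    \<rho> F \<le> A F over \<open>T\<close> gives \<rho> \<le> b.\<close>
  define b where "b = (\<Sum>\<xi>\<in>T. \<Sum>\<eta>\<in>T. \<bar>B \<xi> \<eta>\<bar>)"
  define Q where "Q = {p. log_lip_on M' T (snd p) \<and> (\<Sum>\<xi>\<in>T. snd p \<xi>) = 1
      \<and> log_lip_on M T (\<lambda>\<xi>. A (snd p) \<xi> - fst p * snd p \<xi>)}"
  define K where "K = ({c..b} \<times> cube) \<inter> Q"
  have "compact cube"
  proof -
    have "compactin (product_topology (\<lambda>i. euclidean) UNIV) cube"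
      unfolding cube_def compactin_PiE by auto
    then show ?thesis by (simp add: euclidean_product_topology)
  qed
  moreover have "closed Q"
  proof -
    have ev: "continuous_on UNIV (\<lambda>p::real \<times> (real \<Rightarrow> real). snd p x)" for x
      by (rule continuous_on_compose2[OF continuous_on_product_coordinates[of x] continuous_on_snd]) auto
    have "closed {p::real \<times> (real \<Rightarrow> real). log_lip_on M' T (snd p)}"
      unfolding log_lip_on_def Ball_def
      by (intro closed_Collect_all closed_Collect_imp closed_Collect_le continuous_intros ev) auto
    moreover have "closed {p::real \<times> (real \<Rightarrow> real). (\<Sum>\<xi>\<in>T. snd p \<xi>) = 1}"
      by (intro closed_Collect_eq continuous_intros ev)
    moreover have "closed {p::real \<times> (real \<Rightarrow> real). log_lip_on M T (\<lambda>\<xi>. A (snd p) \<xi> - fst p * snd p \<xi>)}"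
      unfolding log_lip_on_def Ball_def mat_app_def
      by (intro closed_Collect_all closed_Collect_imp closed_Collect_le continuous_intros ev) auto
    ultimately show ?thesis unfolding Q_def by (intro closed_Collect_conj)
  qed
  ultimately have compK: "compact K" unfolding K_def
    by (intro compact_Int_closed compact_Times) auto
  \<comment> \<open>Dividing by the positive sum of the values turns any nonzero \<open>F\<close>
    with an admissible \<rho> into a normalised member of \<open>K\<close> with the same
    \<rho>.\<close>
  have inK: "\<exists>F'. (\<rho>, F') \<in> K" if F: "log_lip_on M' T F" "\<exists>\<xi>\<in>T. F \<xi> \<noteq> 0"
      and \<rho>: "log_lip_on M T (\<lambda>\<xi>. A F \<xi> - \<rho> * F \<xi>)" "c \<le> \<rho>" for F \<rho>
  proof -
    obtain \<xi> where \<xi>: "\<xi> \<in> T" "F \<xi> \<noteq> 0" using F(2) by blast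
    define s where "s = (\<Sum>\<eta>\<in>T. F \<eta>)"
    have F0: "\<And>\<eta>. \<eta> \<in> T \<Longrightarrow> F \<eta> \<ge> 0" using nonneg'[OF F(1)] .
    have "F \<xi> \<le> s" unfolding s_def by (intro member_le_sum) (use \<xi> F0 fin in auto)
    then have s: "s > 0" using F0[OF \<xi>(1)] \<xi>(2) by linarith
    define F' where "F' = (\<lambda>x. if x \<in> T then 1 / s * F x else 0)"
    have F': "F' x = 1 / s * F x" if "x \<in> T" for x using that by (simp add: F'_def)
    have AF': "A F' = (\<lambda>\<xi>. 1 / s * A F \<xi>)"
      using mat_app_cong[of T F' "\<lambda>x. 1 / s * F x" B] F' mat_app_scale by metis
    have sum1: "(\<Sum>\<eta>\<in>T. F' \<eta>) = 1" using s by (simp add: F'_def s_def flip: sum_divide_distrib)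
    have F'0: "F' \<eta> \<ge> 0" for \<eta> using F0 s by (simp add: F'_def)
    have F'1: "F' \<eta> \<le> 1" if "\<eta> \<in> T" for \<eta>
      unfolding sum1[symmetric] by (intro member_le_sum) (use that F'0 fin in auto)
    have "log_lip_on M' T F'"
      using log_lip_on_scale[of "1 / s" M' T F] F s F' log_lip_on_cong[of T F'] by simp
    moreover have L: "log_lip_on M T (\<lambda>\<xi>. A F' \<xi> - \<rho> * F' \<xi>)"
    proof -
      have "log_lip_on M T (\<lambda>\<xi>. 1 / s * (A F \<xi> - \<rho> * F \<xi>))" using \<rho> s by (intro log_lip_on_scale) auto
      moreover have "A F' \<xi> - \<rho> * F' \<xi> = 1 / s * (A F \<xi> - \<rho> * F \<xi>)" if "\<xi> \<in> T" for \<xi>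
        unfolding AF' F'[OF that] by (simp add: algebra_simps)
      ultimately show ?thesis
        using log_lip_on_cong[of T "\<lambda>\<xi>. A F' \<xi> - \<rho> * F' \<xi>" "\<lambda>\<xi>. 1 / s * (A F \<xi> - \<rho> * F \<xi>)" M] by blast
    qed
    moreover have "\<rho> \<le> b"
    proof -
      have "\<rho> = (\<Sum>\<xi>\<in>T. \<rho> * F' \<xi>)" using sum1 by (simp flip: sum_distrib_left)
      also have "\<dots> \<le> (\<Sum>\<xi>\<in>T. A F' \<xi>)" using nonneg[OF L] by (intro sum_mono) auto
      also have "\<dots> \<le> b" unfolding b_def mat_app_def
      proof (intro sum_mono)
        fix \<xi> \<eta> assume "\<eta> \<in> T"
        have "B \<xi> \<eta> *\<^sub>R F' \<eta> \<le> \<bar>B \<xi> \<eta>\<bar> * F' \<eta>" using F'0 by (simp add: mult_right_mono)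
        also have "\<dots> \<le> \<bar>B \<xi> \<eta>\<bar> * 1" using F'1[OF \<open>\<eta> \<in> T\<close>] by (intro mult_left_mono) auto
        finally show "B \<xi> \<eta> *\<^sub>R F' \<eta> \<le> \<bar>B \<xi> \<eta>\<bar>" by simp
      qed
      finally show ?thesis .
    qed
    moreover have "F' \<in> cube" using F'0 F'1 by (simp add: cube_def PiE_iff) (simp add: F'_def)
    ultimately show ?thesis using sum1 \<rho>(2) by (auto simp: K_def Q_def)
  qed
  show ?thesis
  proof (cases "\<exists>\<xi>\<in>T. A V \<xi> \<noteq> 0")
    case False
    then show ?thesis using zero[OF V _ _ sup] pos \<xi>0 by fastforce
  next
    case True
    \<comment> \<open>\<open>K\<close> asks for membership in the smaller cone, so the starting
      point is \<open>A V\<close> rather than \<open>V\<close>; applying \<open>A\<close> to the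
      hypothesis shows that \<open>c\<close> is admissible for it.\<close>
    have "log_lip_on M T (\<lambda>\<xi>. A (A V) \<xi> - c * A V \<xi>)"
    proof -
      have "A (\<lambda>\<xi>. A V \<xi> - c * V \<xi>) = (\<lambda>\<xi>. A (A V) \<xi> - c * A V \<xi>)"
        by (simp add: mat_app_def[of _ _ "\<lambda>\<xi>. mat_app T B V \<xi> - c * V \<xi>"] mat_app_def[of _ _ "mat_app T B V"] right_diff_distrib sum_subtractf)
          (simp add: mat_app_def sum_distrib_left algebra_simps)
      then show ?thesis using weaken[OF inv[OF sup]] by simp
    qed
    then have "K \<noteq> {}" using inK[OF inv[OF V] True] by blast
    then obtain p where p: "p \<in> K" "\<And>q. q \<in> K \<Longrightarrow> fst q \<le> fst p"
      using continuous_attains_sup[OF compK _ continuous_on_fst[OF continuous_on_id]] by auto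
    define \<rho> where "\<rho> = fst p"
    define F where "F = snd p"
    define D where "D = (\<lambda>\<xi>. A F \<xi> - \<rho> * F \<xi>)"
    have F: "log_lip_on M' T F" "(\<Sum>\<xi>\<in>T. F \<xi>) = 1" and D: "log_lip_on M T D" and \<rho>: "c \<le> \<rho>"
      using p(1) by (auto simp: K_def Q_def \<rho>_def F_def D_def)
    have F0: "\<exists>\<xi>\<in>T. F \<xi> \<noteq> 0" using F(2) by (metis sum.neutral zero_neq_one)
    have AD: "A D = (\<lambda>\<xi>. A (A F) \<xi> - \<rho> * A F \<xi>)"
      by (simp add: D_def mat_app_def[of _ _ "\<lambda>\<xi>. mat_app T B F \<xi> - \<rho> * F \<xi>"] mat_app_def[of _ _ "mat_app T B F"] right_diff_distrib sum_subtractf)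
        (simp add: mat_app_def sum_distrib_left algebra_simps)
    show ?thesis
    proof (cases "\<exists>\<xi>\<in>T. A F \<xi> \<noteq> 0")
      case False
      then show ?thesis using zero[OF weaken[OF F(1)] F0 _ D[unfolded D_def] \<rho>] by blast
    next
      case AF0: True
      show ?thesis
      proof (cases "\<exists>\<xi>\<in>T. A D \<xi> \<noteq> 0")
        case False
        then show ?thesis using AF0 \<rho> unfolding AD
          by (intro exI[of _ \<rho>] exI[of _ "A F"]) auto
      next
        case True
        have AD': "log_lip_on M' T (A D)" using inv[OF D] .
        have ADpos: "A D \<xi> > 0" if "\<xi> \<in> T" for \<xi>
          using True log_lip_on_pos[OF AD' that] nonneg'[OF AD'] by (metis less_eq_real_def)
        obtain \<epsilon> where \<epsilon>: "\<epsilon> > 0"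
          "\<And>F s. (\<forall>\<eta>\<in>T. \<bar>F \<eta>\<bar> \<le> s) \<Longrightarrow> log_lip_on M T (\<lambda>x. s * A D x + \<epsilon> * F x)"
          using log_lip_on_interior[OF fin M'(2) AD' ADpos] by blast
        \<comment> \<open>A bound for \<open>A F\<close>, so that
          \<open>s * A D - \<epsilon> * A F\<close> lies in the cone. Divided by \<open>s\<close>
          this makes \<rho> + \<epsilon>/s admissible for \<open>A F\<close>, against the maximality
          of \<rho>.\<close>
        define s where "s = (\<Sum>\<xi>\<in>T. \<bar>A F \<xi>\<bar>)"
        have sb: "\<bar>A F \<xi>\<bar> \<le> s" if "\<xi> \<in> T" for \<xi>
          unfolding s_def by (intro member_le_sum) (use that fin in auto)
        have s: "s > 0" using AF0 sb by (metis abs_le_zero_iff not_le order.trans)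
        have "log_lip_on M T (\<lambda>x. s * A D x + \<epsilon> * (- A F x))" using \<epsilon>(2)[of "\<lambda>x. - A F x" s] sb by simp
        from log_lip_on_scale[OF _ this, of "1 / s"] s
        have "log_lip_on M T (\<lambda>x. A D x - \<epsilon> / s * A F x)" by (simp add: field_simps)
        then have "log_lip_on M T (\<lambda>x. A (A F) x - (\<rho> + \<epsilon> / s) * A F x)"
          unfolding AD by (simp add: algebra_simps)
        then obtain F' where "(\<rho> + \<epsilon> / s, F') \<in> K"
          using inK[OF inv[OF weaken[OF F(1)]] AF0, of "\<rho> + \<epsilon> / s"] \<rho> divide_pos_pos[OF \<epsilon>(1) s] by auto
        from p(2)[OF this] show ?thesis using s \<epsilon>(1) by (simp add: \<rho>_def divide_le_0_iff)
      qed
    qed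
  qed
qed

end

section \<open>From power bounds and eigenvectors to the complex spectrum\<close>

lemma mat_app_funpow_complex_bound:
  assumes bound: "\<And>k F s \<xi>. (\<forall>\<eta>\<in>T. \<bar>F \<eta>\<bar> \<le> s) \<Longrightarrow> \<xi> \<in> T \<Longrightarrow> \<bar>(mat_app T B ^^ k) F \<xi>\<bar> \<le> C * c ^ k * s"
    and f: "\<forall>\<eta>\<in>T. cmod (f \<eta>) \<le> s" and \<xi>: "\<xi> \<in> T"
  shows "cmod ((mat_app T B ^^ k) f \<xi>) \<le> 2 * C * c ^ k * s"
proof -
  have lin: "linear Re" "linear Im"
    by (simp_all add: bounded_linear.linear bounded_linear_Re bounded_linear_Im)
  have "\<bar>Re ((mat_app T B ^^ k) f \<xi>)\<bar> \<le> C * c ^ k * s" "\<bar>Im ((mat_app T B ^^ k) f \<xi>)\<bar> \<le> C * c ^ k * s"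
    using bound[of "\<lambda>x. Re (f x)" s \<xi> k] bound[of "\<lambda>x. Im (f x)" s \<xi> k] f \<xi>
      abs_Re_le_cmod abs_Im_le_cmod
    unfolding mat_app_funpow_linear[OF lin(1)] mat_app_funpow_linear[OF lin(2)]
    by (meson order.trans)+
  then show ?thesis using cmod_le[of "(mat_app T B ^^ k) f \<xi>"] by simp
qed

lemma complexify_op_mat_app:
  assumes L: "\<And>F \<xi>. \<xi> \<in> T \<Longrightarrow> L F \<xi> = mat_app T B F \<xi>" and "\<xi> \<in> T"
  shows "complexify_op T L f \<xi> = mat_app T B f \<xi>"
  using assms by (simp add: complexify_op_def mat_app_def complex_eq_iff)

lemma CX_finite: "finite T \<Longrightarrow> CX T = extensional T"
  by (auto simp: CX_def continuous_on_finite)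

lemma cmod_le_sup_norm_on: "finite T \<Longrightarrow> \<xi> \<in> T \<Longrightarrow> cmod (f \<xi>) \<le> sup_norm_on T f"
  unfolding sup_norm_on_def by (intro cSUP_upper) auto

text \<open>The bound on the powers makes the Neumann series of A^j / z^(j+1) converge
  geometrically. Its sum inverts the shifted operator, and the same majorant bounds the
  inverse.\<close>

lemma not_in_op_spectrum:
  assumes fin: "finite T" and ne: "T \<noteq> {}"
    and L: "\<And>F \<xi>. \<xi> \<in> T \<Longrightarrow> L F \<xi> = mat_app T B F \<xi>"
    and C: "C \<ge> 0"
    and bound: "\<And>k F s \<xi>. (\<forall>\<eta>\<in>T. \<bar>F \<eta>\<bar> \<le> s) \<Longrightarrow> \<xi> \<in> T \<Longrightarrow> \<bar>(mat_app T B ^^ k) F \<xi>\<bar> \<le> C * c ^ k * s"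
    and c: "0 \<le> c" "c < cmod z"
  shows "z \<notin> op_spectrum T L"
proof -
  let ?A = "mat_app T B :: (real \<Rightarrow> complex) \<Rightarrow> real \<Rightarrow> complex"
  have z: "z \<noteq> 0" "cmod z > 0" using c by auto
  have shift: "shifted_op T L z f = (\<lambda>x\<in>T. z * f x - ?A f x)" for f
    unfolding shifted_op_def using complexify_op_mat_app[OF L] by (auto simp: fun_eq_iff restrict_def)
  define summand where "summand g \<xi> j = (?A ^^ j) g \<xi> / z ^ Suc j" for g \<xi> j
  \<comment> \<open>Sum of the geometric majorant with ratio c/|z|; the factor 2 comes from bounding
    real and imaginary parts separately.\<close>
  define K where "K = 2 * C / cmod z * (1 / (1 - c / cmod z))"
  have q: "0 \<le> c / cmod z" "c / cmod z < 1" using c z by (auto simp: divide_less_eq)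
  have K: "K \<ge> 0" unfolding K_def using C q by (intro mult_nonneg_nonneg divide_nonneg_nonneg) auto
  have tb: "cmod (summand g \<xi> j) \<le> 2 * C / cmod z * s * (c / cmod z) ^ j"
    if "\<forall>\<eta>\<in>T. cmod (g \<eta>) \<le> s" "\<xi> \<in> T" for g s \<xi> j
  proof -
    have "cmod (summand g \<xi> j) \<le> 2 * C * c ^ j * s / cmod z ^ Suc j"
      unfolding summand_def norm_divide norm_power
      by (intro divide_right_mono mat_app_funpow_complex_bound[OF bound that]) auto
    then show ?thesis by (simp add: power_divide field_simps)
  qed
  have geo: "(\<lambda>j. 2 * C / cmod z * s * (c / cmod z) ^ j) sums (K * s)" for s
  proof -
    have "(\<lambda>j. (c / cmod z) ^ j) sums (1 / (1 - c / cmod z))" using q by (intro geometric_sums) simp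
    from sums_mult[OF this, of "2 * C / cmod z * s"] show ?thesis by (simp add: K_def algebra_simps)
  qed
  have bd: "\<forall>\<eta>\<in>T. cmod (g \<eta>) \<le> sup_norm_on T g" for g using cmod_le_sup_norm_on[OF fin] by blast
  have summ: "summable (summand g \<xi>)" if "\<xi> \<in> T" for g \<xi>
    using summable_comparison_test'[OF sums_summable[OF geo] tb[OF bd that]] .
  have le: "cmod (suminf (summand g \<xi>)) \<le> K * sup_norm_on T g" if "\<xi> \<in> T" for g \<xi>
  proof -
    have "cmod (suminf (summand g \<xi>)) \<le> (\<Sum>j. 2 * C / cmod z * sup_norm_on T g * (c / cmod z) ^ j)"
      by (rule norm_suminf_le[OF tb[OF bd that] sums_summable[OF geo]])
    then show ?thesis using sums_unique[OF geo] by simp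
  qed
  \<comment> \<open>Telescoping the Neumann series gives injectivity and the norm estimate at once.\<close>
  have resolvent: "f \<xi> = suminf (summand (shifted_op T L z f) \<xi>)" if \<xi>: "\<xi> \<in> T" for f \<xi>
  proof -
    let ?g = "shifted_op T L z f"
    have iter: "(?A ^^ j) ?g \<xi> = z * (?A ^^ j) f \<xi> - (?A ^^ Suc j) f \<xi>" for j
    proof (cases j)
      case 0
      then show ?thesis using \<xi> by (simp add: shift)
    next
      case (Suc i)
      have "?A ?g = ?A (\<lambda>x. z * f x + - 1 * ?A f x)" by (rule mat_app_cong) (simp add: shift)
      then have "(?A ^^ j) ?g = (?A ^^ j) (\<lambda>x. z * f x + - 1 * ?A f x)"
        unfolding Suc funpow_Suc_right by simp
      also have "\<dots> = (\<lambda>\<xi>. z * (?A ^^ j) f \<xi> + - 1 * (?A ^^ j) (?A f) \<xi>)"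
        unfolding mat_app_funpow_add mat_app_funpow_scale ..
      finally show ?thesis by (simp add: funpow_swap1)
    qed
    have "(\<Sum>j<k. summand ?g \<xi> j) = f \<xi> - (?A ^^ k) f \<xi> / z ^ k" for k
    proof (induction k)
      case (Suc k)
      have "summand ?g \<xi> k = (?A ^^ k) f \<xi> / z ^ k - (?A ^^ Suc k) f \<xi> / z ^ Suc k"
        unfolding summand_def iter using z by (simp add: diff_divide_distrib)
      then show ?case using Suc by simp
    qed simp
    \<comment> \<open>The remainder is \<open>z\<close> times the k-th term of the convergent series
      for \<open>f\<close>.\<close>
    moreover have "(\<lambda>k. (?A ^^ k) f \<xi> / z ^ k) \<longlonglongrightarrow> 0"
    proof -
      have "(\<lambda>k. z * summand f \<xi> k) \<longlonglongrightarrow> z * 0"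
        by (intro tendsto_intros summable_LIMSEQ_zero summ[OF \<xi>])
      then show ?thesis using z by (simp add: summand_def)
    qed
    ultimately have "summand ?g \<xi> sums (f \<xi> - 0)"
      unfolding sums_def by (simp only:) (intro tendsto_intros)
    then show ?thesis by (simp add: sums_iff)
  qed
  have "bij_betw (shifted_op T L z) (CX T) (CX T)"
    unfolding bij_betw_def CX_finite[OF fin]
  proof
    show "inj_on (shifted_op T L z) (extensional T)"
      by (rule inj_onI, rule extensionalityI[of _ T]) (assumption | metis resolvent)+
    show "shifted_op T L z ` extensional T = extensional T"
    proof
      show "shifted_op T L z ` extensional T \<subseteq> extensional T" by (auto simp: shift)
      show "extensional T \<subseteq> shifted_op T L z ` extensional T"
      proof
        fix g :: "real \<Rightarrow> complex" assume g: "g \<in> extensional T"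
        define f where "f = (\<lambda>\<xi>\<in>T. suminf (summand g \<xi>))"
        have "z * f \<xi> - ?A f \<xi> = g \<xi>" if \<xi>: "\<xi> \<in> T" for \<xi>
        proof -
          have "(\<lambda>j. \<Sum>\<eta>\<in>T. B \<xi> \<eta> *\<^sub>R summand g \<eta> j) sums (\<Sum>\<eta>\<in>T. B \<xi> \<eta> *\<^sub>R suminf (summand g \<eta>))"
            by (intro sums_sum sums_scaleR_right summable_sums summ)
          moreover have "(\<Sum>\<eta>\<in>T. B \<xi> \<eta> *\<^sub>R suminf (summand g \<eta>)) = ?A f \<xi>"
            by (simp add: mat_app_def f_def)
          \<comment> \<open>Termwise, the matrix shifts the series by one index and multiplies it by
            \<open>z\<close>; in \<open>z * f - A f\<close> only \<open>z\<close> times the term of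
            index 0 survives, which is \<open>g\<close>.\<close>
          moreover have "(\<Sum>\<eta>\<in>T. B \<xi> \<eta> *\<^sub>R summand g \<eta> j) = z * summand g \<xi> (Suc j)" for j
          proof -
            have "(\<Sum>\<eta>\<in>T. B \<xi> \<eta> *\<^sub>R summand g \<eta> j) = (\<Sum>\<eta>\<in>T. B \<xi> \<eta> *\<^sub>R (?A ^^ j) g \<eta>) / z ^ Suc j"
              unfolding summand_def sum_divide_distrib by (simp add: scaleR_conv_of_real)
            also have "\<dots> = z * summand g \<xi> (Suc j)"
              using z by (simp add: summand_def mat_app_def[of T B "(?A ^^ j) g"])
            finally show ?thesis .
          qed
          ultimately have "(\<lambda>j. z * summand g \<xi> (Suc j)) sums ?A f \<xi>" by simp
          then have "(\<lambda>j. z * summand g \<xi> j) sums (?A f \<xi> + z * summand g \<xi> 0)"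
            by (subst sums_Suc_iff[symmetric])
          moreover have "(\<lambda>j. z * summand g \<xi> j) sums (z * f \<xi>)"
            using \<xi> summ[OF \<xi>] by (intro sums_mult) (simp add: f_def summable_sums)
          ultimately have "z * f \<xi> = ?A f \<xi> + z * summand g \<xi> 0" using sums_unique2 by blast
          then show ?thesis using z by (simp add: summand_def)
        qed
        then have "shifted_op T L z f = g"
          unfolding shift using g by (intro extensionalityI[of _ T]) auto
        then show "g \<in> shifted_op T L z ` extensional T"
          by (metis f_def imageI restrict_extensional)
      qed
    qed
  qed
  moreover have "sup_norm_on T f \<le> K * sup_norm_on T (shifted_op T L z f)" for f
    unfolding sup_norm_on_def[of T f]
    by (rule cSUP_least[OF ne]) (use le resolvent in metis)
  ultimately show ?thesis unfolding op_spectrum_def by blast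
qed

lemma eigenvalue_in_op_spectrum:
  assumes fin: "finite T" and L: "\<And>F \<xi>. \<xi> \<in> T \<Longrightarrow> L F \<xi> = mat_app T B F \<xi>"
    and F: "\<exists>\<xi>\<in>T. F \<xi> \<noteq> 0" "\<forall>\<xi>\<in>T. mat_app T B F \<xi> = \<rho> * F \<xi>"
  shows "complex_of_real \<rho> \<in> op_spectrum T L"
proof -
  have shift: "shifted_op T L z f = (\<lambda>x\<in>T. z * f x - mat_app T B f x)" for z f
    unfolding shifted_op_def using complexify_op_mat_app[OF L] by (auto simp: fun_eq_iff restrict_def)
  let ?f = "\<lambda>x\<in>T. complex_of_real (F x)" and ?o = "\<lambda>x\<in>T. 0::complex"
  have "mat_app T B ?f = mat_app T B (\<lambda>x. of_real (F x))" by (rule mat_app_cong) simp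
  also have "\<dots> = (\<lambda>\<xi>. of_real (mat_app T B F \<xi>))"
    by (rule mat_app_linear) (simp add: bounded_linear.linear bounded_linear_of_real)
  finally have f: "shifted_op T L (of_real \<rho>) ?f = (\<lambda>x\<in>T. 0)"
    using F(2) by (auto simp: shift fun_eq_iff restrict_def)
  have "mat_app T B ?o = (\<lambda>\<xi>. 0)" by (simp add: mat_app_def)
  then have "shifted_op T L (of_real \<rho>) ?o = (\<lambda>x\<in>T. 0)"
    by (auto simp: shift fun_eq_iff restrict_def)
  moreover have "?f \<noteq> ?o" using F(1) by (auto simp: fun_eq_iff restrict_def)
  moreover have "?f \<in> CX T" "?o \<in> CX T" by (auto simp: CX_finite[OF fin])
  ultimately have "\<not> inj_on (shifted_op T L (of_real \<rho>)) (CX T)" using f by (metis inj_onD)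
  then show ?thesis unfolding op_spectrum_def bij_betw_def by blast
qed

text \<open>The upper cone estimate excludes all |z| > c, the lower one supplies an eigenvalue. The
  halves support each other: the eigenvalue makes the spectrum nonempty and the bound makes it
  bounded, so the supremum can be estimated on both sides.\<close>

lemma (in cone_preserving) op_spectral_radius_bounds:
  assumes L: "\<And>F \<xi>. \<xi> \<in> T \<Longrightarrow> L F \<xi> = mat_app T B F \<xi>"
    and V: "log_lip_on M'' T V" "M'' < M" "\<And>\<xi>. \<xi> \<in> T \<Longrightarrow> V \<xi> > 0"
    and upper: "c \<ge> 0" "log_lip_on M T (\<lambda>\<xi>. c * V \<xi> - A V \<xi>)"
    and lower: "log_lip_on M T (\<lambda>\<xi>. A V \<xi> - d * V \<xi>)"
  shows "d \<le> op_spectral_radius T L \<and> op_spectral_radius T L \<le> c"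
proof -
  obtain C where C: "C \<ge> 0"
    "\<And>k F s \<xi>. (\<forall>\<eta>\<in>T. \<bar>F \<eta>\<bar> \<le> s) \<Longrightarrow> \<xi> \<in> T \<Longrightarrow> \<bar>(A ^^ k) F \<xi>\<bar> \<le> C * c ^ k * s"
    using funpow_bound[OF upper V] by blast
  have le: "cmod z \<le> c" if "z \<in> op_spectrum T L" for z
    using not_in_op_spectrum[OF fin ne L C upper(1)] that by (meson not_le)
  have "log_lip_on M T V" using log_lip_on_mono[OF V(1)] V(2,3) by (meson less_imp_le)
  from ex_eigenvalue_ge[OF this V(3) lower]
  obtain \<rho> F where \<rho>: "\<rho> \<ge> d" "\<exists>\<xi>\<in>T. F \<xi> \<noteq> 0" "\<forall>\<xi>\<in>T. A F \<xi> = \<rho> * F \<xi>" by blast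
  have in_spec: "complex_of_real \<rho> \<in> op_spectrum T L"
    by (rule eigenvalue_in_op_spectrum[OF fin L \<rho>(2,3)])
  have "d \<le> cmod (complex_of_real \<rho>)" using \<rho>(1) by simp
  also have "\<dots> \<le> op_spectral_radius T L" unfolding op_spectral_radius_def
    by (intro cSUP_upper in_spec bdd_aboveI2[of _ _ c] le)
  finally show ?thesis unfolding op_spectral_radius_def
    using in_spec le by (auto intro!: cSUP_least)
qed

section \<open>The extended Chebyshev grid\<close>

lemma lagrange_basis:
  fixes c :: "nat \<Rightarrow> real"
  assumes "inj_on c {0..r}"
  shows "\<exists>l. \<forall>k\<in>{0..r}. degree (l k) \<le> r \<and> (\<forall>j\<in>{0..r}. poly (l k) (c j) = (if j = k then 1 else 0))"
proof -
  define l where "l k = smult (1 / (\<Prod>j\<in>{0..r} - {k}. c k - c j)) (\<Prod>j\<in>{0..r} - {k}. [:- c j, 1:])" for k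
  have "degree (l k) \<le> r" if "k \<in> {0..r}" for k
  proof -
    have "degree (\<Prod>j\<in>{0..r} - {k}. [:- c j, 1:]) = r"
      using that by (subst degree_prod_sum_eq) auto
    then show ?thesis unfolding l_def by simp
  qed
  moreover have "poly (l k) (c j) = (if j = k then 1 else 0)" if "k \<in> {0..r}" "j \<in> {0..r}" for j k
  proof (cases "j = k")
    case True
    have "(\<Prod>j\<in>{0..r} - {k}. c k - c j) \<noteq> 0"
      using assms that by (auto simp: inj_on_def)
    then show ?thesis using True by (simp add: l_def poly_prod)
  next
    case False
    then have "(\<Prod>i\<in>{0..r} - {k}. c j - c i) = 0" using that by (intro prod_zero) auto
    then show ?thesis using False by (simp add: l_def poly_prod)
  qed
  ultimately show ?thesis by blast
qed

lemma sin_ge_sin_of_distance_to_multiples: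
  assumes "\<delta> \<le> y" "y \<le> pi - \<delta>" "0 \<le> \<delta>" "\<delta> \<le> pi / 2"
  shows "sin \<delta> \<le> sin y"
proof (cases "y \<le> pi / 2")
  case True
  then show ?thesis using assms by (intro sin_monotone_2pi_le) auto
next
  case False
  then have "sin \<delta> \<le> sin (pi - y)" using assms by (intro sin_monotone_2pi_le) auto
  then show ?thesis by simp
qed

context
  fixes r :: nat
  assumes r: "r \<ge> 1"
begin

lemma cheb_base_angle: "0 < pi / real (2 * r + 2)" "pi / real (2 * r + 2) \<le> pi / 4"
proof -
  have "pi / real (2 * r + 2) \<le> pi / 4" by (rule divide_left_mono) (use r in auto)
  then show "0 < pi / real (2 * r + 2)" "pi / real (2 * r + 2) \<le> pi / 4" by auto
qed

lemma cos_base_angle_pos: "cos (pi / real (2 * r + 2)) > 0"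
  using cheb_base_angle pi_gt_zero by (intro cos_gt_zero) linarith+

lemma sin_base_angle_pos: "sin (pi / real (2 * r + 2)) > 0"
  using cheb_base_angle pi_gt_zero by (intro sin_gt_zero) linarith+

lemma cheb_angle: "real (2 * k + 1) / real (2 * r + 2) * pi = real (2 * k + 1) * (pi / real (2 * r + 2))"
  by simp

lemma base_angle_full: "real (2 * r + 2) * (pi / real (2 * r + 2)) = pi"
  by simp

lemma cheb_ref_0: "cheb_ref r 0 = -1"
  using cos_base_angle_pos by (simp add: cheb_ref_def)

lemma cheb_ref_r: "cheb_ref r r = 1"
proof -
  have "real (2 * r + 1) / real (2 * r + 2) * pi = pi - pi / real (2 * r + 2)"
    by (simp add: divide_simps) (simp add: algebra_simps)
  then show ?thesis using cos_base_angle_pos unfolding cheb_ref_def by (simp only: cos_pi_minus) simp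
qed

text \<open>The difference of cosines is 2 sin ((k + l + 1) x) sin ((l - k) x). The arguments stay
  in [2x, pi - 2x] and [x, pi - x], and both sines are smallest for k = 0, l = 1; there the quotient
  by cos x is 4 sin^2 x.\<close>

lemma cheb_ref_gap:
  assumes "k < l" "l \<le> r"
  shows "4 * (sin (pi / real (2 * r + 2)))\<^sup>2 \<le> cheb_ref r l - cheb_ref r k"
proof -
  define x where "x = pi / real (2 * r + 2)"
  have x: "0 < x" "x \<le> pi / 4" "real (2 * r + 2) * x = pi"
    using cheb_base_angle base_angle_full by (auto simp: x_def)
  have pi: "pi = 2 * (real r * x) + 2 * x" using x(3) by (simp add: algebra_simps)
  have mono: "a \<le> b \<Longrightarrow> real a * x \<le> real b * x" for a b using x by (simp add: mult_right_mono)
  have cx: "cos x > 0" using cos_base_angle_pos by (simp add: x_def)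
  have s1: "sin (2 * x) \<le> sin (real (k + l + 1) * x)"
  proof (rule sin_ge_sin_of_distance_to_multiples)
    show "2 * x \<le> real (k + l + 1) * x" using mono[of 2 "k + l + 1"] assms by simp
    show "real (k + l + 1) * x \<le> pi - 2 * x"
      using mono[of "k + l + 1" "2 * r"] assms pi by simp
  qed (use x in auto)
  have s2: "sin x \<le> sin (real (l - k) * x)"
  proof (rule sin_ge_sin_of_distance_to_multiples)
    show "x \<le> real (l - k) * x" using mono[of 1 "l - k"] assms by simp
    have "real (l - k) * x \<le> real r * x" "real 0 * x \<le> real r * x" by (rule mono, use assms in simp)+
    then show "real (l - k) * x \<le> pi - x" using pi x(1) by linarith
  qed (use x in auto)
  have "cheb_ref r l - cheb_ref r k = (cos (real (2 * k + 1) * x) - cos (real (2 * l + 1) * x)) / cos x"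
    unfolding cheb_ref_def cheb_angle x_def by (simp add: diff_divide_distrib)
  also have "cos (real (2 * k + 1) * x) - cos (real (2 * l + 1) * x)
      = 2 * (sin (real (k + l + 1) * x) * sin (real (l - k) * x))"
  proof -
    have "(real (2 * k + 1) * x + real (2 * l + 1) * x) / 2 = real (k + l + 1) * x"
      "(real (2 * l + 1) * x - real (2 * k + 1) * x) / 2 = real (l - k) * x"
      using assms by (auto simp: field_simps of_nat_diff)
    then show ?thesis unfolding cos_diff_cos by simp
  qed
  finally have eq: "cheb_ref r l - cheb_ref r k
      = 2 * (sin (real (k + l + 1) * x) * sin (real (l - k) * x)) / cos x" .
  have "4 * (sin x)\<^sup>2 = 2 * (sin (2 * x) * sin x) / cos x"
    using cx by (simp add: sin_double power2_eq_square)
  also have "\<dots> \<le> cheb_ref r l - cheb_ref r k"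
  proof -
    have "0 \<le> sin (2 * x)" "0 \<le> sin x" using x(1,2) by (auto intro!: sin_ge_zero)
    then have "sin (2 * x) * sin x \<le> sin (real (k + l + 1) * x) * sin (real (l - k) * x)"
      by (intro mult_mono s1 s2 order.trans[OF _ s1])
    then show ?thesis unfolding eq using cx by (intro divide_right_mono mult_left_mono) auto
  qed
  finally show ?thesis by (simp add: x_def)
qed

end

text \<open>The left side of \<open>gap\<close> is the minimal node distance inside a cell of the
  left interval; requiring it between intervals too gives one separation bound for the whole
  grid.\<close>

locale cheb_mesh =
  fixes r I :: nat and lo hi :: "nat \<Rightarrow> real" and N :: "nat \<Rightarrow> nat"
  assumes r: "r \<ge> 1" and I: "I \<ge> 1"
    and ivl: "\<And>i. i \<in> {1..I} \<Longrightarrow> lo i < hi i \<and> N i \<ge> 1"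
    and gap_pos: "\<And>i. i \<in> {1..<I} \<Longrightarrow> hi i < lo (i + 1)"
    and gap: "\<And>i. i \<in> {1..<I} \<Longrightarrow>
        2 * (sin (pi / real (2 * r + 2)))\<^sup>2 * mesh_width lo hi N i \<le> lo (i + 1) - hi i"
begin

abbreviation "w \<equiv> mesh_width lo hi N"
abbreviation "t \<equiv> mesh_point lo hi N"
abbreviation "c \<equiv> cheb_point r lo hi N"
abbreviation "T \<equiv> cheb_grid r I lo hi N"
abbreviation "x0 \<equiv> pi / real (2 * r + 2)"
abbreviation "interp \<equiv> pw_interpolant r I lo hi N"

section \<open>Cells of the mesh and separation of the grid points\<close>

lemma width_pos: "i \<in> {1..I} \<Longrightarrow> w i > 0"
  using ivl[of i] by (simp add: mesh_width_def)

lemma mesh_point_0: "t i 0 = lo i"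
  by (simp add: mesh_point_def)

lemma mesh_point_N: "i \<in> {1..I} \<Longrightarrow> t i (N i) = hi i"
  using ivl[of i] by (simp add: mesh_point_def mesh_width_def)

lemma mesh_point_step: "j \<ge> 1 \<Longrightarrow> t i j = t i (j - 1) + w i"
  by (cases j) (auto simp: mesh_point_def algebra_simps)

lemma mesh_point_mono: "i \<in> {1..I} \<Longrightarrow> j \<le> j' \<Longrightarrow> t i j \<le> t i j'"
  using width_pos[of i] by (simp add: mesh_point_def mult_right_mono)

lemma mesh_point_less: "i \<in> {1..I} \<Longrightarrow> j < j' \<Longrightarrow> t i j + w i \<le> t i j'"
  using mesh_point_mono[of i "Suc j" j'] mesh_point_step[of "Suc j" i] by simp

lemma cheb_point_0: "c i j 0 = t i (j - 1)"
  by (simp add: cheb_point_def cheb_ref_0[OF r])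

lemma cheb_point_r: "j \<ge> 1 \<Longrightarrow> c i j r = t i j"
  by (simp add: cheb_point_def cheb_ref_r[OF r] mesh_point_step)

lemma cheb_point_gap:
  assumes "i \<in> {1..I}" "k < l" "l \<le> r"
  shows "2 * (sin x0)\<^sup>2 * w i \<le> c i j l - c i j k"
proof -
  have "c i j l - c i j k = w i / 2 * (cheb_ref r l - cheb_ref r k)"
    by (simp add: cheb_point_def field_simps)
  also have "\<dots> \<ge> w i / 2 * (4 * (sin x0)\<^sup>2)"
    using cheb_ref_gap[OF r assms(2,3)] width_pos[OF assms(1)] by (intro mult_left_mono) auto
  finally show ?thesis by (simp add: algebra_simps)
qed

lemma min_gap_pos: "i \<in> {1..I} \<Longrightarrow> 0 < 2 * (sin x0)\<^sup>2 * w i"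
  using sin_base_angle_pos[OF r] width_pos[of i] by simp

lemma cheb_point_less: "i \<in> {1..I} \<Longrightarrow> k < l \<Longrightarrow> l \<le> r \<Longrightarrow> c i j k < c i j l"
  using cheb_point_gap[of i k l j] min_gap_pos[of i] by linarith

lemma cheb_point_mono: "i \<in> {1..I} \<Longrightarrow> k \<le> l \<Longrightarrow> l \<le> r \<Longrightarrow> c i j k \<le> c i j l"
  using cheb_point_less[of i k l j] by (cases "k = l") auto

lemma cheb_point_bounds:
  assumes "i \<in> {1..I}" "j \<ge> 1" "k \<le> r"
  shows "t i (j - 1) \<le> c i j k" "c i j k \<le> t i j"
  using cheb_point_mono[of i 0 k j] cheb_point_mono[of i k r j] assms
  by (simp_all add: cheb_point_0 cheb_point_r)

lemma cheb_point_inj: "i \<in> {1..I} \<Longrightarrow> inj_on (c i j) {0..r}"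
  by (rule linorder_inj_onI') (metis atLeastAtMost_iff cheb_point_less less_irrefl)

lemma cell_subset:
  assumes "i \<in> {1..I}" "j \<in> {1..N i}"
  shows "{t i (j - 1)..t i j} \<subseteq> {lo i..hi i}"
proof -
  have "lo i \<le> t i (j - 1)" using mesh_point_mono[OF assms(1), of 0 "j - 1"] by (simp add: mesh_point_0)
  moreover have "t i j \<le> hi i"
    using mesh_point_mono[OF assms(1), of j "N i"] assms(2) mesh_point_N[OF assms(1)] by simp
  ultimately show ?thesis by auto
qed

lemma ex_cell:
  assumes i: "i \<in> {1..I}" and x: "x \<in> {lo i..hi i}"
  shows "\<exists>j\<in>{1..N i}. x \<in> {t i (j - 1)..t i j}"
proof -
  define j where "j = (LEAST j. j \<ge> 1 \<and> x \<le> t i j)"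
  have N: "N i \<ge> 1 \<and> x \<le> t i (N i)" using ivl[OF i] x mesh_point_N[OF i] by auto
  have j: "j \<ge> 1 \<and> x \<le> t i j" unfolding j_def by (rule LeastI[where P = "\<lambda>j. j \<ge> 1 \<and> x \<le> t i j", OF N])
  have "j \<le> N i" unfolding j_def by (rule Least_le[where P = "\<lambda>j. j \<ge> 1 \<and> x \<le> t i j", OF N])
  moreover have "t i (j - 1) \<le> x"
  proof (cases "j = 1")
    case True
    then show ?thesis using x by (simp add: mesh_point_0)
  next
    case False
    then have "\<not> (j - 1 \<ge> 1 \<and> x \<le> t i (j - 1))"
      using j not_less_Least[of "j - 1" "\<lambda>j. j \<ge> 1 \<and> x \<le> t i j"] by (simp add: j_def)
    then show ?thesis using False j by auto
  qed
  ultimately show ?thesis using j by auto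
qed

lemma lo_mono: "1 \<le> i \<Longrightarrow> i \<le> i' \<Longrightarrow> i' \<le> I \<Longrightarrow> lo i \<le> lo i'"
proof (induction i')
  case (Suc n)
  show ?case
  proof (cases "i = Suc n")
    case False
    then have "lo i \<le> lo n" "n \<in> {1..<I}" using Suc by auto
    then show ?thesis using gap_pos[of n] ivl[of n] by auto
  qed simp
qed simp

lemma interval_gap:
  assumes "i \<in> {1..I}" "i' \<in> {1..I}" "i < i'" "x \<in> {lo i..hi i}" "y \<in> {lo i'..hi i'}"
  shows "2 * (sin x0)\<^sup>2 * w i \<le> y - x"
proof -
  have "lo (i + 1) \<le> lo i'" using assms by (intro lo_mono) auto
  moreover have "2 * (sin x0)\<^sup>2 * w i \<le> lo (i + 1) - hi i" using assms by (intro gap) auto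
  moreover have "x \<le> hi i" "lo i' \<le> y" using assms by auto
  ultimately show ?thesis by linarith
qed

text \<open>\<open>ne\<close> excludes the common end of adjacent cells, which is both the last node
  of one and the first node of the next.\<close>

lemma grid_gap_same_interval:
  assumes i: "i \<in> {1..I}" and j: "1 \<le> j" "j < j'" and k: "k \<le> r" "k' \<le> r"
    and ne: "c i j k \<noteq> c i j' k'"
  shows "2 * (sin x0)\<^sup>2 * w i \<le> c i j' k' - c i j k"
proof -
  have lej: "t i j \<le> t i (j' - 1)" using mesh_point_mono[OF i] j by simp
  have le': "t i (j' - 1) \<le> c i j' k'" using cheb_point_bounds(1)[OF i _ k(2)] j by simp
  have le: "c i j k \<le> t i j" using cheb_point_bounds(2)[OF i j(1) k(1)] .
  \<comment> \<open>If one node is not the end facing the other cell, the gap inside its own cell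
    suffices. Otherwise both are mesh points, and being different they have a whole cell between
    them.\<close>
  consider "k < r" | "0 < k'" | "k = r" "k' = 0" using k by linarith
  then show ?thesis
  proof cases
    case 1
    then show ?thesis using cheb_point_gap[OF i 1, of j] cheb_point_r[OF j(1)] lej le' by auto
  next
    case 2
    then show ?thesis using cheb_point_gap[OF i 2 k(2), of j'] lej le by (auto simp: cheb_point_0)
  next
    case 3
    then have "t i j \<noteq> t i (j' - 1)" using ne cheb_point_r[OF j(1)] by (simp add: cheb_point_0)
    then have "j < j' - 1" using j by (cases "j = j' - 1") auto
    moreover have "2 * (sin x0)\<^sup>2 * w i \<le> w i"
      using cheb_point_gap[OF i, of 0 r 1] r cheb_point_r[of 1 i] mesh_point_step[of 1 i] by (simp add: cheb_point_0)
    ultimately show ?thesis using mesh_point_less[OF i, of j "j' - 1"] 3 cheb_point_r[OF j(1)]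
      by (simp add: cheb_point_0)
  qed
qed

lemma cheb_gridE:
  assumes "\<xi> \<in> T"
  obtains i j k where "i \<in> {1..I}" "j \<in> {1..N i}" "k \<le> r" "\<xi> = c i j k" "\<xi> \<in> {lo i..hi i}"
proof -
  obtain i j k where *: "i \<in> {1..I}" "j \<in> {1..N i}" "k \<le> r" "\<xi> = c i j k"
    using assms unfolding cheb_grid_def by auto
  moreover from * have "\<xi> \<in> {t i (j - 1)..t i j}" using cheb_point_bounds by auto
  ultimately show ?thesis using cell_subset that by blast
qed

lemma grid_gap:
  assumes "\<xi> \<in> T" "\<eta> \<in> T" "\<xi> \<noteq> \<eta>"
  shows "2 * (sin x0)\<^sup>2 * (MIN i\<in>{1..I}. w i) \<le> \<bar>\<xi> - \<eta>\<bar>"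
proof -
  have min: "2 * (sin x0)\<^sup>2 * (MIN i\<in>{1..I}. w i) \<le> 2 * (sin x0)\<^sup>2 * w i" if "i \<in> {1..I}" for i
    using that by (intro mult_left_mono Min_le) auto
  obtain i j k where 1: "i \<in> {1..I}" "j \<in> {1..N i}" "k \<le> r" "\<xi> = c i j k" "\<xi> \<in> {lo i..hi i}"
    using assms(1) by (rule cheb_gridE)
  obtain i' j' k' where 2: "i' \<in> {1..I}" "j' \<in> {1..N i'}" "k' \<le> r" "\<eta> = c i' j' k'" "\<eta> \<in> {lo i'..hi i'}"
    using assms(2) by (rule cheb_gridE)
  consider "i < i'" | "i' < i" | "i = i'" "j < j'" | "i = i'" "j' < j" | "i = i'" "j = j'" "k < k'"
    | "i = i'" "j = j'" "k' < k"
    using assms(3) 1(4) 2(4) by (metis linorder_neqE_nat)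
  then have "2 * (sin x0)\<^sup>2 * w i \<le> \<bar>\<xi> - \<eta>\<bar> \<or> 2 * (sin x0)\<^sup>2 * w i' \<le> \<bar>\<xi> - \<eta>\<bar>"
  proof cases
    case 3
    then show ?thesis using grid_gap_same_interval[of i j j' k k'] 1 2 assms(3) by auto
  next
    case 4
    then show ?thesis using grid_gap_same_interval[of i j' j k' k] 1 2 assms(3) by auto
  next
    case 5
    then show ?thesis using cheb_point_gap[of i k k' j] 1 2 by auto
  next
    case 6
    then show ?thesis using cheb_point_gap[of i k' k j] 1 2 by auto
  qed (use interval_gap[of i i' \<xi> \<eta>] interval_gap[of i' i \<eta> \<xi>] 1 2 in auto)
  then show ?thesis using min[OF 1(1)] min[OF 2(1)] by auto
qed

lemma finite_grid: "finite T"
proof -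
  have "T = (\<Union>i\<in>{1..I}. \<Union>j\<in>{1..N i}. c i j ` {0..r})" unfolding cheb_grid_def by blast
  then show ?thesis by simp
qed

lemma cheb_point_in_grid: "i \<in> {1..I} \<Longrightarrow> j \<in> {1..N i} \<Longrightarrow> k \<in> {0..r} \<Longrightarrow> c i j k \<in> T"
  unfolding cheb_grid_def by blast

lemma grid_two:
  assumes "\<xi> \<in> T"
  shows "\<exists>\<eta>\<in>T. \<xi> \<noteq> \<eta>"
proof -
  have i: "1 \<in> {1..I}" using I by simp
  have j: "1 \<in> {1..N 1}" using ivl[OF i] by simp
  have "c 1 1 0 \<noteq> c 1 1 1" using cheb_point_gap[OF i, of 0 1 1] min_gap_pos[OF i] r by auto
  moreover have "c 1 1 0 \<in> T" "c 1 1 1 \<in> T" using cheb_point_in_grid[OF i j] r by auto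
  ultimately show ?thesis by metis
qed

lemma grid_nonempty: "T \<noteq> {}"
proof -
  have "c 1 1 0 \<in> T" using ivl[of 1] I by (intro cheb_point_in_grid) auto
  then show ?thesis by blast
qed

section \<open>Piecewise interpolation: uniqueness, linearity and error\<close>

definition interpolates :: "nat \<Rightarrow> nat \<Rightarrow> real poly \<Rightarrow> (real \<Rightarrow> real) \<Rightarrow> bool" where
  "interpolates i j q F \<longleftrightarrow> degree q \<le> r \<and> (\<forall>k\<in>{0..r}. poly q (c i j k) = F (c i j k))"

text \<open>Justifies the definite description in \<open>pw_interpolant\<close>. In one cell the r +
  1 nodes determine the polynomial; distinct cells meet at most in a common end, which is a node of
  both.\<close>

lemma interpolates_unique_on_overlap:
  assumes 1: "i \<in> {1..I}" "j \<in> {1..N i}" "x \<in> {t i (j - 1)..t i j}" "interpolates i j q F"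
    and 2: "i' \<in> {1..I}" "j' \<in> {1..N i'}" "x \<in> {t i' (j' - 1)..t i' j'}" "interpolates i' j' q' F"
  shows "poly q x = poly q' x"
proof -
  have less: "poly q x = poly q' x"
    if i: "i \<in> {1..I}" and j: "1 \<le> j" "j < j'" and x: "x \<le> t i j" "t i (j' - 1) \<le> x"
      and q: "interpolates i j q F" "interpolates i j' q' F" for i j j' q q'
  proof -
    have "t i j \<le> t i (j' - 1)" using mesh_point_mono[OF i] j by simp
    then have eq: "x = t i j" "x = t i (j' - 1)" using x by auto
    have "poly q x = F x" using q(1) cheb_point_r[OF j(1)] unfolding interpolates_def eq(1) by (metis atLeastAtMost_iff le0 order_refl)
    moreover have "poly q' x = F x" using q(2) cheb_point_0[of i j'] unfolding interpolates_def eq(2) by (metis atLeastAtMost_iff le0 order_refl)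
    ultimately show ?thesis by simp
  qed
  have x: "x \<in> {lo i..hi i}" "x \<in> {lo i'..hi i'}" using cell_subset 1 2 by blast+
  consider "i < i'" | "i' < i" | "i = i'" "j < j'" | "i = i'" "j' < j" | "i = i'" "j = j'"
    by (metis linorder_neqE_nat)
  then show ?thesis
  proof cases
    case 5
    have "q = q'"
    proof (rule poly_eqI_degree[where A = "c i j ` {0..r}"])
      show "card (c i j ` {0..r}) > degree q" "card (c i j ` {0..r}) > degree q'"
        using 1 2 5 cheb_point_inj[OF 1(1), of j] by (auto simp: card_image interpolates_def)
    qed (use 1 2 5 in \<open>auto simp: interpolates_def\<close>)
    then show ?thesis by simp
  next
    case 1
    show ?thesis using interval_gap[OF assms(1,5) 1 x] min_gap_pos[OF assms(1)] by simp
  next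
    case 2
    show ?thesis using interval_gap[OF assms(5,1) 2 x(2,1)] min_gap_pos[OF assms(5)] by simp
  next
    case 3
    show ?thesis by (rule less[of i j j']) (use 3 1 2 in auto)
  next
    case 4
    show ?thesis by (rule less[of i j' j, symmetric]) (use 4 1 2 in auto)
  qed
qed

lemma pw_interpolant_eq:
  assumes "i \<in> {1..I}" "j \<in> {1..N i}" "x \<in> {t i (j - 1)..t i j}" "interpolates i j q F"
  shows "interp F x = poly q x"
  unfolding pw_interpolant_def
proof (rule the_equality)
  show "\<exists>i\<in>{1..I}. \<exists>j\<in>{1..N i}. \<exists>q'. x \<in> {t i (j - 1)..t i j} \<and> degree q' \<le> r \<and>
      (\<forall>k\<in>{0..r}. poly q' (c i j k) = F (c i j k)) \<and> poly q x = poly q' x"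
    using assms unfolding interpolates_def by blast
next
  fix y assume "\<exists>i\<in>{1..I}. \<exists>j\<in>{1..N i}. \<exists>q. x \<in> {t i (j - 1)..t i j} \<and> degree q \<le> r \<and>
      (\<forall>k\<in>{0..r}. poly q (c i j k) = F (c i j k)) \<and> y = poly q x"
  then obtain i' j' q' where "i' \<in> {1..I}" "j' \<in> {1..N i'}" "x \<in> {t i' (j' - 1)..t i' j'}"
      "interpolates i' j' q' F" "y = poly q' x"
    unfolding interpolates_def by blast
  then show "y = poly q x" using interpolates_unique_on_overlap[OF assms] by metis
qed

text \<open>The polynomials \<open>l\<close> are chosen before \<open>F\<close>, so the interpolant
  is linear in the data; this is what turns the operator into a matrix.\<close>

lemma ex_interpolates:
  assumes i: "i \<in> {1..I}"
  shows "\<exists>l. \<forall>F. interpolates i j (\<Sum>k=0..r. smult (F (c i j k)) (l k)) F"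
proof -
  obtain l where l: "\<And>k. k \<in> {0..r} \<Longrightarrow> degree (l k) \<le> r"
      "\<And>k m. k \<in> {0..r} \<Longrightarrow> m \<in> {0..r} \<Longrightarrow> poly (l k) (c i j m) = (if m = k then 1 else 0)"
    using lagrange_basis[OF cheb_point_inj[OF i, of j]] by metis
  have "interpolates i j (\<Sum>k=0..r. smult (F (c i j k)) (l k)) F" for F
    unfolding interpolates_def
  proof
    show "degree (\<Sum>k=0..r. smult (F (c i j k)) (l k)) \<le> r"
      using l(1) by (intro degree_sum_le) (auto intro: order.trans[OF degree_smult_le])
    show "\<forall>m\<in>{0..r}. poly (\<Sum>k=0..r. smult (F (c i j k)) (l k)) (c i j m) = F (c i j m)"
    proof
      fix m assume m: "m \<in> {0..r}"
      have "poly (\<Sum>k=0..r. smult (F (c i j k)) (l k)) (c i j m)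
          = (\<Sum>k=0..r. if m = k then F (c i j k) else 0)"
        unfolding poly_sum poly_smult using l(2) m by (intro sum.cong) auto
      then show "poly (\<Sum>k=0..r. smult (F (c i j k)) (l k)) (c i j m) = F (c i j m)" using m by simp
    qed
  qed
  then show ?thesis by blast
qed

lemma pw_interpolant_linear:
  assumes i: "i \<in> {1..I}" and x: "x \<in> {lo i..hi i}"
  shows "\<exists>l. \<forall>F. interp F x = (\<Sum>\<eta>\<in>T. l \<eta> * F \<eta>)"
proof -
  obtain j where j: "j \<in> {1..N i}" "x \<in> {t i (j - 1)..t i j}" using ex_cell[OF i x] by blast
  obtain l where l: "\<And>F. interpolates i j (\<Sum>k=0..r. smult (F (c i j k)) (l k)) F"
    using ex_interpolates[OF i] by metis
  \<comment> \<open>The coefficient of \<open>F \<eta>\<close> is the basis polynomial of the node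
    equal to \<eta>, and 0 for grid points that are not nodes of this cell.\<close>
  have "interp F x = (\<Sum>\<eta>\<in>T. (\<Sum>k=0..r. if c i j k = \<eta> then poly (l k) x else 0) * F \<eta>)" for F
  proof -
    have "interp F x = (\<Sum>k=0..r. F (c i j k) * poly (l k) x)"
      using pw_interpolant_eq[OF i j l] by (simp add: poly_sum)
    also have "\<dots> = (\<Sum>k=0..r. \<Sum>\<eta>\<in>T. if c i j k = \<eta> then poly (l k) x * F \<eta> else 0)"
      using cheb_point_in_grid[OF i j(1)] finite_grid by (intro sum.cong) (auto simp: sum.delta')
    also have "\<dots> = (\<Sum>\<eta>\<in>T. \<Sum>k=0..r. if c i j k = \<eta> then poly (l k) x * F \<eta> else 0)"
      by (rule sum.swap)
    also have "\<dots> = (\<Sum>\<eta>\<in>T. (\<Sum>k=0..r. if c i j k = \<eta> then poly (l k) x else 0) * F \<eta>)"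
      by (auto simp: sum_distrib_right intro!: sum.cong)
    finally show ?thesis .
  qed
  then show ?thesis by (intro exI allI)
qed

text \<open>The nodes are Chebyshev zeros stretched by 1 / cos x0 to reach the ends of the cell. In
  the variable \<open>- (y * cos x0)\<close>, which stays in [-1, 1], the product becomes the
  Chebyshev one, with a factor w / (2 cos x0), up to sign, for each node.\<close>

lemma cheb_point_product_le:
  assumes i: "i \<in> {1..I}" and j: "j \<ge> 1" and x: "x \<in> {t i (j - 1)..t i j}"
  shows "\<bar>\<Prod>k=0..r. x - c i j k\<bar> \<le> (w i / (2 * cos x0)) ^ (r + 1) * (1 / 2 ^ r)"
proof -
  define y where "y = 2 * (x - t i (j - 1)) / w i - 1"
  have w: "w i > 0" and cx: "cos x0 > 0" using width_pos[OF i] cos_base_angle_pos[OF r] by auto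
  have x': "x = t i (j - 1) + w i * (1 + y) / 2" using w by (simp add: y_def field_simps)
  have y: "\<bar>y\<bar> \<le> 1" using x mesh_point_step[OF j, of i] w by (auto simp: y_def abs_le_iff field_simps)
  have "x - c i j k = - (w i / (2 * cos x0)) * (- (y * cos x0) - cos (real (2 * k + 1) / real (2 * r + 2) * pi))" for k
    unfolding x' cheb_point_def cheb_ref_def using cx by (simp add: field_simps)
  then have "(\<Prod>k=0..r. x - c i j k) = (- (w i / (2 * cos x0))) ^ (r + 1) *
      (\<Prod>k=0..r. - (y * cos x0) - cos (real (2 * k + 1) / real (2 * r + 2) * pi))"
    by (simp only: prod.distrib) simp
  moreover have "\<bar>- (w i / (2 * cos x0))\<bar> = w i / (2 * cos x0)" using w cx by simp
  ultimately have "\<bar>\<Prod>k=0..r. x - c i j k\<bar> = (w i / (2 * cos x0)) ^ (r + 1) *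
      \<bar>\<Prod>k=0..r. - (y * cos x0) - cos (real (2 * k + 1) / real (2 * r + 2) * pi)\<bar>"
    by (simp only: abs_mult power_abs)
  moreover have "\<bar>y\<bar> * cos x0 \<le> 1 * 1" using y cx by (intro mult_mono) auto
  then have "\<bar>- (y * cos x0)\<bar> \<le> 1" using cx by (simp add: abs_mult)
  ultimately show ?thesis
    using chebyshev_node_product_le[of "- (y * cos x0)" r] w cx by (simp only:) (intro mult_left_mono, auto)
qed

text \<open>\<open>E\<close> bounds the derivative only within one cell width of \<open>x\<close>,
  where the intermediate point lies; so \<open>K\<close> may later be a multiple of the value at
  \<open>x\<close>, which makes the error relative.\<close>

lemma pw_interpolant_error:
  assumes i: "i \<in> {1..I}" and sub: "{lo i..hi i} \<subseteq> S" and x: "x \<in> {lo i..hi i}"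
    and der: "\<And>k x. k < Suc r \<Longrightarrow> x \<in> S \<Longrightarrow> (D k has_real_derivative D (Suc k) x) (at x within S)"
    and E: "\<And>\<zeta>. \<zeta> \<in> S \<Longrightarrow> \<bar>\<zeta> - x\<bar> \<le> w i \<Longrightarrow> \<bar>D (Suc r) \<zeta>\<bar> \<le> K"
    and F: "\<And>\<xi>. \<xi> \<in> T \<Longrightarrow> F \<xi> = D 0 \<xi>"
  shows "\<bar>interp F x - D 0 x\<bar> \<le> K / fact (r + 1) * ((w i / (2 * cos x0)) ^ (r + 1) * (1 / 2 ^ r))"
proof -
  obtain j where j: "j \<in> {1..N i}" "x \<in> {t i (j - 1)..t i j}" using ex_cell[OF i x] by blast
  obtain l where "\<And>F. interpolates i j (\<Sum>k=0..r. smult (F (c i j k)) (l k)) F"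
    using ex_interpolates[OF i] by metis
  then obtain q where q: "interpolates i j q F" by blast
  have cell: "{t i (j - 1)..t i j} \<subseteq> S" using cell_subset[OF i j(1)] sub by blast
  have "\<exists>\<zeta>\<in>{t i (j - 1)..t i j}.
      D 0 x - poly q x = D (Suc r) \<zeta> / fact (Suc r) * (\<Prod>k=0..r. x - c i j k)"
  proof (rule interpolation_error)
    show "inj_on (c i j) {0..r}" by (rule cheb_point_inj[OF i])
    show "c i j ` {0..r} \<subseteq> {t i (j - 1)..t i j}" using cheb_point_bounds[OF i] j by auto
    show "degree q \<le> r" using q by (simp add: interpolates_def)
    show "poly q (c i j k) = D 0 (c i j k)" if "k \<in> {0..r}" for k
      using q F cheb_point_in_grid[OF i j(1) that] that by (simp add: interpolates_def)
    show "(D k has_real_derivative D (Suc k) x) (at x within {t i (j - 1)..t i j})"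
      if "k < Suc r" "x \<in> {t i (j - 1)..t i j}" for k x
      using has_field_derivative_subset[OF der cell] that cell by blast
  qed (use j in auto)
  then obtain \<zeta> where \<zeta>: "\<zeta> \<in> {t i (j - 1)..t i j}"
    "D 0 x - poly q x = D (Suc r) \<zeta> / fact (Suc r) * (\<Prod>k=0..r. x - c i j k)" by blast
  have "\<bar>\<zeta> - x\<bar> \<le> w i" using \<zeta>(1) j mesh_point_step[of j i] by auto
  then have K: "\<bar>D (Suc r) \<zeta>\<bar> \<le> K" using E \<zeta>(1) cell by blast
  have "\<bar>interp F x - D 0 x\<bar> = \<bar>D 0 x - poly q x\<bar>" using pw_interpolant_eq[OF i j q] by simp
  also have "\<dots> = \<bar>D (Suc r) \<zeta>\<bar> / fact (Suc r) * \<bar>\<Prod>k=0..r. x - c i j k\<bar>"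
    unfolding \<zeta>(2) by (simp add: abs_mult)
  also have "\<dots> \<le> K / fact (Suc r) * ((w i / (2 * cos x0)) ^ (r + 1) * (1 / 2 ^ r))"
    using K cheb_point_product_le[OF i _ j(2)] j by (intro mult_mono divide_right_mono) auto
  finally show ?thesis by simp
qed

end

section \<open>The discretised transfer operator\<close>

lemma words_0: "words n 0 = {[]}"
  by (auto simp: words_def)

lemma words_Suc: "words n (Suc \<nu>) = (\<lambda>(p, \<omega>). p # \<omega>) ` ({1..n} \<times> words n \<nu>)"
  by (force simp: words_def length_Suc_conv)

lemma word_map_in:
  assumes "\<And>p. p \<in> {1..n} \<Longrightarrow> \<theta> p \<in> S \<rightarrow> S" and "set \<omega> \<subseteq> {1..n}" "t \<in> S"
  shows "word_map \<theta> \<omega> t \<in> S"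
  using assms(2,3) by (induction \<omega>) (use assms(1) in auto)

lemma word_weight_nonneg:
  assumes "\<And>p. p \<in> {1..n} \<Longrightarrow> \<theta> p \<in> S \<rightarrow> S" "\<And>p. p \<in> {1..n} \<Longrightarrow> g p \<in> S \<rightarrow> {0..}"
    and "set \<omega> \<subseteq> {1..n}" "t \<in> S"
  shows "word_weight \<theta> g \<omega> t \<ge> 0"
  using assms(3,4)
proof (induction \<omega>)
  case (Cons p \<omega>)
  then have "word_map \<theta> \<omega> t \<in> S" using word_map_in[OF assms(1)] by auto
  then have "g p (word_map \<theta> \<omega> t) \<ge> 0" using assms(2)[of p] Cons.prems by auto
  then show ?case using Cons by simp
qed simp

text \<open>The iterated eigenvalue equation written over words. The letter put in front acts last,
  so the sum over it is \<open>transfer_op\<close> at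
  \<open>word_map \<theta> \<omega> t\<close>.\<close>

lemma words_sum_eigenfunction:
  assumes \<theta>: "\<And>p. p \<in> {1..n} \<Longrightarrow> \<theta> p \<in> S \<rightarrow> S" and g: "\<And>p. p \<in> {1..n} \<Longrightarrow> g p \<in> S \<rightarrow> {0..}"
    and ev: "\<forall>t\<in>S. transfer_op S n \<theta> g s v t = lam * v t" and t: "t \<in> S"
  shows "(\<Sum>\<omega>\<in>words n \<nu>. word_weight \<theta> g \<omega> t powr s * v (word_map \<theta> \<omega> t)) = lam ^ \<nu> * v t"
proof (induction \<nu>)
  case 0
  then show ?case by (simp add: words_0)
next
  case (Suc \<nu>)
  have inj: "inj_on (\<lambda>(p, \<omega>). p # \<omega>) ({1..n} \<times> words n \<nu>)" by (auto simp: inj_on_def)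
  have "(\<Sum>\<omega>\<in>words n (Suc \<nu>). word_weight \<theta> g \<omega> t powr s * v (word_map \<theta> \<omega> t))
      = (\<Sum>(p, \<omega>)\<in>{1..n} \<times> words n \<nu>. word_weight \<theta> g (p # \<omega>) t powr s * v (word_map \<theta> (p # \<omega>) t))"
    unfolding words_Suc by (subst sum.reindex[OF inj]) (simp add: case_prod_beta)
  also have "\<dots> = (\<Sum>\<omega>\<in>words n \<nu>. \<Sum>p=1..n. word_weight \<theta> g (p # \<omega>) t powr s * v (word_map \<theta> (p # \<omega>) t))"
    unfolding sum.cartesian_product[symmetric] by (rule sum.swap)
  also have "\<dots> = (\<Sum>\<omega>\<in>words n \<nu>. lam * (word_weight \<theta> g \<omega> t powr s * v (word_map \<theta> \<omega> t)))"
  proof (rule sum.cong[OF refl])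
    fix \<omega> assume "\<omega> \<in> words n \<nu>"
    then have \<omega>: "set \<omega> \<subseteq> {1..n}" by (simp add: words_def)
    have x: "word_map \<theta> \<omega> t \<in> S" by (rule word_map_in[OF \<theta> \<omega> t])
    have w: "word_weight \<theta> g \<omega> t \<ge> 0" by (rule word_weight_nonneg[OF \<theta> g \<omega> t])
    have "(\<Sum>p=1..n. word_weight \<theta> g (p # \<omega>) t powr s * v (word_map \<theta> (p # \<omega>) t))
       = (\<Sum>p=1..n. word_weight \<theta> g \<omega> t powr s * (g p (word_map \<theta> \<omega> t) powr s * v (\<theta> p (word_map \<theta> \<omega> t))))"
      using g x w by (intro sum.cong) (auto simp: powr_mult Pi_iff)
    also have "\<dots> = word_weight \<theta> g \<omega> t powr s * transfer_op S n \<theta> g s v (word_map \<theta> \<omega> t)"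
      using x by (simp add: transfer_op_def sum_distrib_left)
    also have "\<dots> = lam * (word_weight \<theta> g \<omega> t powr s * v (word_map \<theta> \<omega> t))"
      using ev x by simp
    finally show "(\<Sum>p=1..n. word_weight \<theta> g (p # \<omega>) t powr s * v (word_map \<theta> (p # \<omega>) t)) = \<dots>" .
  qed
  also have "\<dots> = lam ^ Suc \<nu> * v t" unfolding sum_distrib_left[symmetric] Suc by simp
  finally show ?case .
qed

lemma log_lip_cone_iff: "F \<in> log_lip_cone M T \<longleftrightarrow> F \<in> extensional T \<and> log_lip_on M T F"
  by (simp add: log_lip_cone_def log_lip_on_def)

lemma nth_deriv_on_has_derivative:
  assumes "Cm_on m S f" "k < m" "x \<in> S"
  shows "(nth_deriv_on S k f has_real_derivative nth_deriv_on S (Suc k) f x) (at x within S)"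
  using assms unfolding Cm_on_def
  by (simp add: vector_derivative_works has_real_derivative_iff_has_vector_derivative)

lemma (in cheb_mesh) discrete_op_matrix:
  assumes "\<And>\<omega> \<xi>. \<omega> \<in> words n \<nu> \<Longrightarrow> \<xi> \<in> T \<Longrightarrow> \<exists>i\<in>{1..I}. word_map \<theta> \<omega> \<xi> \<in> {lo i..hi i}"
  shows "\<exists>B. \<forall>F. \<forall>\<xi>\<in>T. discrete_op n \<theta> g s \<nu> r I lo hi N F \<xi> = mat_app T B F \<xi>"
proof -
  have "\<exists>l. \<forall>F. interp F (word_map \<theta> \<omega> \<xi>) = (\<Sum>\<eta>\<in>T. l \<eta> * F \<eta>)" if "\<omega> \<in> words n \<nu>" "\<xi> \<in> T" for \<omega> \<xi>
    using assms[OF that] pw_interpolant_linear by blast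
  then obtain l where l: "\<And>\<omega> \<xi> F. \<omega> \<in> words n \<nu> \<Longrightarrow> \<xi> \<in> T \<Longrightarrow>
      interp F (word_map \<theta> \<omega> \<xi>) = (\<Sum>\<eta>\<in>T. l \<omega> \<xi> \<eta> * F \<eta>)" by metis
  define B where "B \<xi> \<eta> = (\<Sum>\<omega>\<in>words n \<nu>. word_weight \<theta> g \<omega> \<xi> powr s * l \<omega> \<xi> \<eta>)" for \<xi> \<eta>
  have "discrete_op n \<theta> g s \<nu> r I lo hi N F \<xi> = mat_app T B F \<xi>" if "\<xi> \<in> T" for F \<xi>
  proof -
    have "discrete_op n \<theta> g s \<nu> r I lo hi N F \<xi>
        = (\<Sum>\<omega>\<in>words n \<nu>. \<Sum>\<eta>\<in>T. word_weight \<theta> g \<omega> \<xi> powr s * (l \<omega> \<xi> \<eta> * F \<eta>))"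
      using that l by (simp add: discrete_op_def sum_distrib_left)
    also have "\<dots> = (\<Sum>\<eta>\<in>T. \<Sum>\<omega>\<in>words n \<nu>. word_weight \<theta> g \<omega> \<xi> powr s * (l \<omega> \<xi> \<eta> * F \<eta>))"
      by (rule sum.swap)
    also have "\<dots> = mat_app T B F \<xi>"
      by (simp add: mat_app_def B_def sum_distrib_right mult.assoc)
    finally show ?thesis .
  qed
  then show ?thesis by blast
qed

theorem theorem6p5:
  fixes a b s E chi h \<mu> G H M M' M\<^sub>1 M\<^sub>2 lam :: real
    and n r m \<nu> I :: nat
    and \<theta> g :: "nat \<Rightarrow> real \<Rightarrow> real"
    and v :: "real \<Rightarrow> real"
    and lo hi :: "nat \<Rightarrow> real"
    and N :: "nat \<Rightarrow> nat"
    and S T :: "real set"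
    and LL :: "(real \<Rightarrow> real) \<Rightarrow> real \<Rightarrow> real"
  assumes "a < b" and S: "S = {a..b}"
    and "n \<ge> 1" and "s > 0" and "r \<ge> 1" and "m \<ge> r + 1"
    and "\<forall>p\<in>{1..n}. \<theta> p \<in> S \<rightarrow> S \<and> Cm_on m S (\<theta> p)"
    and "\<forall>p\<in>{1..n}. g p \<in> S \<rightarrow> {0..} \<and> Cm_on m S (g p) \<and> (\<exists>t\<in>S. g p t \<noteq> 0)"
    and "\<exists>M\<^sub>0>0. \<forall>p\<in>{1..n}. \<forall>t\<^sub>1\<in>S. \<forall>t\<^sub>2\<in>S. g p t\<^sub>1 \<le> g p t\<^sub>2 * exp (M\<^sub>0 * \<bar>t\<^sub>1 - t\<^sub>2\<bar>)"
    and "\<exists>C\<^sub>0\<ge>1. \<exists>\<kappa>. 0 < \<kappa> \<and> \<kappa> < 1 \<and>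
           (\<forall>k\<ge>1. \<forall>\<omega>\<in>words n k. \<forall>t\<^sub>1\<in>S. \<forall>t\<^sub>2\<in>S.
              \<bar>word_map \<theta> \<omega> t\<^sub>1 - word_map \<theta> \<omega> t\<^sub>2\<bar> \<le> C\<^sub>0 * \<kappa> ^ k * \<bar>t\<^sub>1 - t\<^sub>2\<bar>)"
    and lam: "lam = op_spectral_radius S (transfer_op S n \<theta> g s)"
    and "Cm_on m S v" and "\<forall>t\<in>S. v t > 0"
    and "\<forall>t\<in>S. transfer_op S n \<theta> g s v t = lam * v t"
    and "E > 0" and "chi > 0"
    and "\<forall>t\<in>S. \<bar>nth_deriv_on S (r + 1) v t\<bar> / v t \<le> E"
    and "\<forall>x\<^sub>1\<in>S. \<forall>x\<^sub>2\<in>S. v x\<^sub>1 \<le> v x\<^sub>2 * exp (2 * s * \<bar>x\<^sub>1 - x\<^sub>2\<bar> / chi)"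
    and "\<nu> \<ge> 1" and "I \<ge> 1"
    and "\<forall>i\<in>{1..I}. lo i < hi i \<and> {lo i..hi i} \<subseteq> S \<and> N i \<ge> 1"
    and "\<forall>i\<in>{1..<I}. hi i < lo (i + 1)"
    and "\<forall>\<omega>\<in>words n \<nu>. \<exists>i\<in>{1..I}. word_map \<theta> \<omega> ` S \<subseteq> {lo i..hi i}"
    and h: "h = (MAX i\<in>{1..I}. mesh_width lo hi N i)"
    and mu: "\<mu> = h / (MIN i\<in>{1..I}. mesh_width lo hi N i)"
    and "\<forall>i\<in>{1..<I}.
           2 * (sin (pi / real (2 * r + 2)))\<^sup>2 * mesh_width lo hi N i \<le> lo (i + 1) - hi i"
    and T: "T = cheb_grid r I lo hi N"
    and LL: "LL = discrete_op n \<theta> g s \<nu> r I lo hi N"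
    and G: "G = E * exp (2 * s * h / chi) * (1 / fact (r + 1))
                 * (1 / (2 * cos (pi / real (2 * r + 2)))) ^ (r + 1) * (1 / 2 ^ r)"
    and "G * h ^ (r + 1) < 1"
    and M1: "M\<^sub>1 = \<mu> * (G * h ^ r / (1 - G\<^sup>2 * h ^ (2 * r + 2)))
                   * (1 / sin (pi / real (2 * r + 2)))\<^sup>2 + 2 * s / chi"
    and "H > G" and "h < 1"
    and M2: "M\<^sub>2 = M\<^sub>1 + G / H * (\<mu> / (1 - (G / H * h)\<^sup>2))
                   * (1 / (sin (pi / real (2 * r + 2)))\<^sup>2)"
    and "0 < M'" and "M' < M" and "M \<ge> M\<^sub>2"
    and "LL ` log_lip_cone M T \<subseteq> log_lip_cone M' T"
  shows "lam ^ \<nu> * (1 - H * h ^ r) \<le> op_spectral_radius T LL \<and>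
         op_spectral_radius T LL \<le> lam ^ \<nu> * (1 + H * h ^ r)"
proof -
  note v_smooth = assms(12) and v_eigen = assms(14) and v_deriv_le = assms(17)
    and v_log_lip = assms(18) and intervals = assms(21) and word_images = assms(23)
    and LL_cone = assms(38)
  interpret mesh: cheb_mesh r I lo hi N
    by unfold_locales (use assms(5,20,21,22,26) in auto)
  define w where "w = mesh_width lo hi N"
  define x0 where "x0 = pi / real (2 * r + 2)"
  define \<epsilon> where "\<epsilon> = G / H * h"
  define wmin where "wmin = (MIN i\<in>{1..I}. w i)"
  have w_pos: "w i > 0" if "i \<in> {1..I}" for i using mesh.width_pos[OF that] by (simp add: w_def)
  have w_le: "w i \<le> h" if "i \<in> {1..I}" for i using that by (simp add: h w_def)
  have h_pos: "h > 0" using w_pos[of 1] w_le[of 1] \<open>I \<ge> 1\<close> by auto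
  have wmin_pos: "wmin > 0" unfolding wmin_def using w_pos \<open>I \<ge> 1\<close> by (subst Min_gr_iff) auto
  have mu': "\<mu> = h / wmin" by (simp add: mu wmin_def w_def)
  have mu_pos: "\<mu> > 0" using mu' h_pos wmin_pos by simp
  have cx: "cos x0 > 0" and sx: "sin x0 > 0"
    using cos_base_angle_pos sin_base_angle_pos \<open>r \<ge> 1\<close> by (auto simp only: x0_def)
  have G_pos: "G > 0" unfolding G using \<open>E > 0\<close> cx by (simp add: x0_def)
  have H_pos: "H > 0" using G_pos \<open>H > G\<close> by simp
  have eps0: "0 \<le> \<epsilon>" using G_pos H_pos h_pos by (simp add: \<epsilon>_def)
  have "G / H < 1" using G_pos \<open>H > G\<close> by simp
  then have eps1: "\<epsilon> < 1"
    using mult_strict_mono[of "G / H" 1 h 1] \<open>h < 1\<close> h_pos G_pos H_pos by (simp add: \<epsilon>_def)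
  have eps2: "1 - \<epsilon>\<^sup>2 > 0" using eps0 eps1 by (simp add: power_less_one_iff abs_square_less_1)
  \<comment> \<open>The second summand of \<open>M\<^sub>2\<close>. It is rewritten below as the
    increase of the rate in \<open>log_lip_on_perturb\<close> for relative error \<epsilon> and
    separation \<open>d = 2 sin^2 x0 * wmin\<close>.\<close>
  define \<Delta> where "\<Delta> = G / H * (\<mu> / (1 - \<epsilon>\<^sup>2)) * (1 / (sin x0)\<^sup>2)"
  have \<Delta>_pos: "\<Delta> > 0"
    unfolding \<Delta>_def using G_pos H_pos mu_pos eps2 sx by simp
  have \<Delta>: "\<Delta> = 2 * \<epsilon> / ((1 - \<epsilon>\<^sup>2) * (2 * (sin x0)\<^sup>2 * wmin))"
    unfolding \<Delta>_def mu' using eps2 sx wmin_pos H_pos by (simp add: \<epsilon>_def[symmetric] field_simps) (simp add: \<epsilon>_def)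
  have "M\<^sub>1 \<ge> 2 * s / chi"
  proof -
    have "(G * h ^ (r + 1))\<^sup>2 < 1"
      using \<open>G * h ^ (r + 1) < 1\<close> G_pos h_pos unfolding abs_square_less_1 by simp
    moreover have "2 * r + 2 = (r + 1) * 2" by simp
    then have "(G * h ^ (r + 1))\<^sup>2 = G\<^sup>2 * h ^ (2 * r + 2)"
      by (simp only: power_mult power_mult_distrib)
    ultimately have "1 - G\<^sup>2 * h ^ (2 * r + 2) > 0" by simp
    then have "\<mu> * (G * h ^ r / (1 - G\<^sup>2 * h ^ (2 * r + 2))) * (1 / sin x0)\<^sup>2 \<ge> 0"
      using mu_pos G_pos h_pos by (intro mult_nonneg_nonneg divide_nonneg_pos) auto
    then show ?thesis unfolding M1 x0_def by simp
  qed
  \<comment> \<open>The first summand of \<open>M\<^sub>1\<close> is nonnegative, so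
    \<open>M\<close> accommodates the rate \<open>2 * s / chi\<close> of \<open>v\<close> together
    with the loss \<Delta>.\<close>
  then have M_ge: "2 * s / chi + \<Delta> \<le> M"
    using \<open>M \<ge> M\<^sub>2\<close> unfolding M2 \<Delta>_def \<epsilon>_def x0_def by linarith
  have \<theta>S: "\<And>p. p \<in> {1..n} \<Longrightarrow> \<theta> p \<in> S \<rightarrow> S" and gS: "\<And>p. p \<in> {1..n} \<Longrightarrow> g p \<in> S \<rightarrow> {0..}"
    using assms(7,8) by blast+
  have TS: "\<xi> \<in> S" if "\<xi> \<in> T" for \<xi>
    using mesh.cheb_gridE[OF that[unfolded T]] intervals by blast
  have v_pos: "v \<xi> > 0" if "\<xi> \<in> S" for \<xi> using that assms(13) by blast
  have v_cone: "log_lip_on (2 * s / chi) T v"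
    unfolding log_lip_on_def using TS v_log_lip by (simp add: mult.commute)

  \<comment> \<open>The derivative at the intermediate point \<zeta> is at most E v(\<zeta>);
    passing from \<zeta> to \<open>x\<close>, at most \<open>h\<close> away, costs the exponential
    factor contained in \<open>G\<close>.\<close>
  have interp_err: "\<bar>pw_interpolant r I lo hi N v x - v x\<bar> \<le> G * h ^ (r + 1) * v x"
    if i: "i \<in> {1..I}" and x: "x \<in> {lo i..hi i}" for i x
  proof -
    have sub: "{lo i..hi i} \<subseteq> S" using intervals i by blast
    then have xS: "x \<in> S" using x by blast
    let ?K = "E * exp (2 * s * h / chi) * v x"
    have "\<bar>pw_interpolant r I lo hi N v x - nth_deriv_on S 0 v x\<bar>
        \<le> ?K / fact (r + 1) * ((w i / (2 * cos x0)) ^ (r + 1) * (1 / 2 ^ r))"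
      unfolding w_def x0_def
    proof (rule mesh.pw_interpolant_error[OF i sub x])
      show "(nth_deriv_on S k v has_real_derivative nth_deriv_on S (Suc k) v x) (at x within S)"
        if "k < Suc r" "x \<in> S" for k x
        using nth_deriv_on_has_derivative[OF v_smooth] that \<open>m \<ge> r + 1\<close> by simp
    next
      fix \<zeta> assume \<zeta>: "\<zeta> \<in> S" "\<bar>\<zeta> - x\<bar> \<le> mesh_width lo hi N i"
      have "\<bar>nth_deriv_on S (Suc r) v \<zeta>\<bar> \<le> E * v \<zeta>"
        using v_deriv_le \<zeta>(1) v_pos[OF \<zeta>(1)] by (simp add: divide_le_eq)
      also have "v \<zeta> \<le> v x * exp (2 * s * \<bar>\<zeta> - x\<bar> / chi)" using v_log_lip \<zeta>(1) xS by blast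
      also have "\<dots> \<le> v x * exp (2 * s * h / chi)"
        using \<zeta>(2) w_le[OF i] v_pos[OF xS] \<open>s > 0\<close> \<open>chi > 0\<close>
        by (intro mult_left_mono) (auto intro!: divide_right_mono mult_left_mono simp: w_def)
      finally show "\<bar>nth_deriv_on S (Suc r) v \<zeta>\<bar> \<le> ?K"
        using \<open>E > 0\<close> by (simp add: ac_simps)
    qed simp
    also have "\<dots> \<le> ?K / fact (r + 1) * ((h / (2 * cos x0)) ^ (r + 1) * (1 / 2 ^ r))"
      using w_le[OF i] w_pos[OF i] cx \<open>E > 0\<close> v_pos[OF xS]
      by (intro mult_left_mono mult_right_mono power_mono divide_right_mono) auto
    also have "\<dots> = G * h ^ (r + 1) * v x"
      unfolding G x0_def by (simp add: power_divide power_mult_distrib ac_simps)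
    finally show ?thesis by simp
  qed

  have in_ivl: "\<exists>i\<in>{1..I}. word_map \<theta> \<omega> \<xi> \<in> {lo i..hi i}" if "\<omega> \<in> words n \<nu>" "\<xi> \<in> T" for \<omega> \<xi>
    using word_images that TS by blast
  obtain B where B: "\<And>F \<xi>. \<xi> \<in> T \<Longrightarrow> LL F \<xi> = mat_app T B F \<xi>"
    using mesh.discrete_op_matrix[of n \<nu> \<theta> g s] in_ivl unfolding T LL by metis

  \<comment> \<open>\<open>lam\<close> is given as a supremum; its sign is read off from the
    eigenvalue equation at \<open>a\<close>, where \<open>v\<close> is positive.\<close>
  have lam_nonneg: "lam \<ge> 0"
  proof -
    have aS: "a \<in> S" using S \<open>a < b\<close> by simp
    have "lam * v a = (\<Sum>p=1..n. g p a powr s * v (\<theta> p a))"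
      using v_eigen aS by (simp add: transfer_op_def)
    also have "\<dots> \<ge> 0"
    proof (intro sum_nonneg mult_nonneg_nonneg)
      fix p assume "p \<in> {1..n}"
      then have "\<theta> p a \<in> S" using \<theta>S aS by blast
      then show "0 \<le> v (\<theta> p a)" using v_pos by (simp add: less_imp_le)
    qed simp
    finally show ?thesis using v_pos[OF aS] by (simp add: zero_le_mult_iff)
  qed

  \<comment> \<open>The weights are nonnegative, so the relative errors at the image points add up
    to the same relative error of the whole sum.\<close>
  have rel_err: "\<bar>mat_app T B v \<xi> - lam ^ \<nu> * v \<xi>\<bar> \<le> G * h ^ (r + 1) * (lam ^ \<nu> * v \<xi>)" if \<xi>: "\<xi> \<in> T" for \<xi>
  proof -
    let ?W = "\<lambda>\<omega>. word_weight \<theta> g \<omega> \<xi> powr s" and ?x = "\<lambda>\<omega>. word_map \<theta> \<omega> \<xi>"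
    have lamv: "(\<Sum>\<omega>\<in>words n \<nu>. ?W \<omega> * v (?x \<omega>)) = lam ^ \<nu> * v \<xi>"
      by (rule words_sum_eigenfunction[OF \<theta>S gS v_eigen TS[OF \<xi>]])
    have diff: "mat_app T B v \<xi> - lam ^ \<nu> * v \<xi>
        = (\<Sum>\<omega>\<in>words n \<nu>. ?W \<omega> * (pw_interpolant r I lo hi N v (?x \<omega>) - v (?x \<omega>)))"
      using \<xi> unfolding B[OF \<xi>, symmetric] lamv[symmetric]
      by (simp add: LL T discrete_op_def right_diff_distrib sum_subtractf)
    have "\<bar>mat_app T B v \<xi> - lam ^ \<nu> * v \<xi>\<bar>
        \<le> (\<Sum>\<omega>\<in>words n \<nu>. ?W \<omega> * (G * h ^ (r + 1) * v (?x \<omega>)))"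
      unfolding diff
    proof (rule order.trans[OF sum_abs], rule sum_mono)
      fix \<omega> assume \<omega>: "\<omega> \<in> words n \<nu>"
      then obtain i where "i \<in> {1..I}" "?x \<omega> \<in> {lo i..hi i}" using in_ivl \<xi> by blast
      from interp_err[OF this]
      show "\<bar>?W \<omega> * (pw_interpolant r I lo hi N v (?x \<omega>) - v (?x \<omega>))\<bar> \<le> ?W \<omega> * (G * h ^ (r + 1) * v (?x \<omega>))"
        unfolding abs_mult by (intro mult_mono) auto
    qed
    also have "\<dots> = G * h ^ (r + 1) * (\<Sum>\<omega>\<in>words n \<nu>. ?W \<omega> * v (?x \<omega>))"
      unfolding sum_distrib_left by (intro sum.cong refl mult.left_commute)
    also have "\<dots> = G * h ^ (r + 1) * (lam ^ \<nu> * v \<xi>)" by (simp only: lamv)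
    finally show ?thesis .
  qed

  \<comment> \<open>The slack \<open>H h\<^sup>r\<close> exceeds the relative error \<open>G h\<^sup>r\<^sup>+\<^sup>1\<close> by the factor \<open>1 / \<epsilon>\<close>, so the error is a
    small relative perturbation of \<open>W\<close> and cannot leave the cone.\<close>
  define W where "W = (\<lambda>\<xi>. lam ^ \<nu> * (H * h ^ r) * v \<xi>)"
  have W0: "W \<xi> \<ge> 0" if "\<xi> \<in> T" for \<xi>
    using lam_nonneg H_pos h_pos v_pos[OF TS[OF that]] by (simp add: W_def)
  have W_cone: "log_lip_on (2 * s / chi) T W"
    unfolding W_def by (rule log_lip_on_scale[OF _ v_cone]) (use lam_nonneg H_pos h_pos in simp)
  have epsW: "\<epsilon> * W \<xi> = G * h ^ (r + 1) * (lam ^ \<nu> * v \<xi>)" for \<xi>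
    using H_pos by (simp add: W_def \<epsilon>_def)
  have perturb: "log_lip_on M T U" if U: "\<And>\<xi>. \<xi> \<in> T \<Longrightarrow> \<bar>U \<xi> - W \<xi>\<bar> \<le> \<epsilon> * W \<xi>" for U
  proof (rule log_lip_on_mono[OF _ M_ge])
    show "log_lip_on (2 * s / chi + \<Delta>) T U"
      unfolding \<Delta>
    proof (rule log_lip_on_perturb[OF W_cone W0 eps0 eps1 U])
      show "0 < 2 * (sin x0)\<^sup>2 * wmin" using sx wmin_pos by simp
      show "2 * (sin x0)\<^sup>2 * wmin \<le> \<bar>\<xi> - \<eta>\<bar>" if "\<xi> \<in> T" "\<eta> \<in> T" "\<xi> \<noteq> \<eta>" for \<xi> \<eta>
        using mesh.grid_gap that unfolding x0_def wmin_def w_def T by blast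
    qed
    show "U \<xi> \<ge> 0" if "\<xi> \<in> T" for \<xi>
    proof -
      have "\<epsilon> * W \<xi> \<le> 1 * W \<xi>" using W0[OF that] eps1 by (intro mult_right_mono) auto
      then show ?thesis using U[OF that] by linarith
    qed
  qed

  interpret cone_preserving T B M M'
  proof
    show "finite T" "T \<noteq> {}" unfolding T by (rule mesh.finite_grid, rule mesh.grid_nonempty)
    show "\<exists>\<eta>\<in>T. \<xi> \<noteq> \<eta>" if "\<xi> \<in> T" for \<xi> using mesh.grid_two that unfolding T by blast
    show "0 < M'" "M' < M" by fact+
    fix F assume F: "log_lip_on M T F"
    \<comment> \<open>The hypothesis on \<open>LL\<close> concerns extensional functions, whereas
      the locale quantifies over all; only values on \<open>T\<close> enter, so \<open>F\<close> may
      be restricted.\<close>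
    have "restrict F T \<in> log_lip_cone M T"
      using F log_lip_on_cong[of T "restrict F T" F M] by (simp add: log_lip_cone_iff)
    then have "log_lip_on M' T (LL (restrict F T))"
      using LL_cone log_lip_cone_iff by blast
    moreover have "LL (restrict F T) \<xi> = mat_app T B F \<xi>" if "\<xi> \<in> T" for \<xi>
      using B[OF that] mat_app_cong[of T "restrict F T" F B] by simp
    ultimately show "log_lip_on M' T (mat_app T B F)"
      using log_lip_on_cong[of T "LL (restrict F T)" "mat_app T B F" M'] by blast
  qed
  show ?thesis
  proof (rule op_spectral_radius_bounds[OF B v_cone])
    show "2 * s / chi < M" using M_ge \<Delta>_pos by simp
    show "v \<xi> > 0" if "\<xi> \<in> T" for \<xi> using v_pos[OF TS[OF that]] .
    show "0 \<le> lam ^ \<nu> * (1 + H * h ^ r)" using lam_nonneg H_pos h_pos by simp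
    \<comment> \<open>This difference and the one below are \<open>W\<close> minus and plus the
      error A v - lam^\<nu> v, which is at most \<epsilon> W in modulus.\<close>
    show "log_lip_on M T (\<lambda>\<xi>. lam ^ \<nu> * (1 + H * h ^ r) * v \<xi> - mat_app T B v \<xi>)"
    proof (rule perturb)
      fix \<xi> assume "\<xi> \<in> T"
      have "lam ^ \<nu> * (1 + H * h ^ r) * v \<xi> - mat_app T B v \<xi> - W \<xi> = - (mat_app T B v \<xi> - lam ^ \<nu> * v \<xi>)"
        by (simp add: W_def algebra_simps)
      then show "\<bar>lam ^ \<nu> * (1 + H * h ^ r) * v \<xi> - mat_app T B v \<xi> - W \<xi>\<bar> \<le> \<epsilon> * W \<xi>"
        using rel_err[OF \<open>\<xi> \<in> T\<close>] unfolding epsW by (simp only: abs_minus_cancel)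
    qed
    show "log_lip_on M T (\<lambda>\<xi>. mat_app T B v \<xi> - lam ^ \<nu> * (1 - H * h ^ r) * v \<xi>)"
    proof (rule perturb)
      fix \<xi> assume "\<xi> \<in> T"
      have "mat_app T B v \<xi> - lam ^ \<nu> * (1 - H * h ^ r) * v \<xi> - W \<xi> = mat_app T B v \<xi> - lam ^ \<nu> * v \<xi>"
        by (simp add: W_def algebra_simps)
      then show "\<bar>mat_app T B v \<xi> - lam ^ \<nu> * (1 - H * h ^ r) * v \<xi> - W \<xi>\<bar> \<le> \<epsilon> * W \<xi>"
        using rel_err[OF \<open>\<xi> \<in> T\<close>] unfolding epsW by (simp only:)
    qed
  qed
qed

end
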